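(* Let $p\colon\mathcal{A}\to G$ be a Fell bundle over an étale groupoid $G$. Let $L\colon C_c(G;\mathcal{A})\to\mathrm{Lin}(\mathcal{H}_0)$ be a pre-representation of $C_c(G;\mathcal{A})$ on a Hilbert space $\mathcal{H}$, where $\mathcal{H}_0\subseteq\mathcal{H}$ is a dense subspace, and let $\mathcal{H}_{00}=\mathrm{span}\{L(f)\xi:f\in C_c(G;\mathcal{A}),\ \xi\in\mathcal{H}_0\}$. Then $L$ can be extended to a representation $M\colon C_c(G;\mathcal{A})\to\mathbb{B}(\mathcal{H})$ that is continuous in the inductive limit topology. To be precise, for $h\in C_c(G;\mathcal{A})$ define the linear operator $M'(h)$ on the inner product space $\mathcal{H}_{00}$, given on generating vectors $L(f)\xi\in\mathcal{H}_{00}$ by \[ M'(h)(L(f)\xi)=L(h*f)\xi,\qquad f\in C_c(G;\mathcal{A}),\ \xi\in\mathcal{H}_0. \] Then: 1. the linear operator $M'(h)$ extends to a bounded linear operator $M(h)\colon\mathcal{H}\to\mathcal{H}$; 2. the map $M\colon C_c(G;\mathcal{A})\to\mathbb{B}(\mathcal{H})$, $h\mapsto M(h)$, is a nondegenerate representation that is continuous in the inductive limit topology on $C_c(G;\mathcal{A})$; 3. $M$ is an extension of $L$, that is, $M(h)|_{\mathcal{H}_0}=L(h)$ for all $h\in C_c(G;\mathcal{A})$.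
   Context: **Étale groupoids.** A topological groupoid $G$ with unit space $G^{(0)}$, range and source maps $r,s$ and set of composable pairs $G^{(2)}$ is étale if $G^{(0)}$ is locally compact Hausdorff in the subspace topology and $r\colon G\to G^{(0)}$ (equivalently $s$) is a local homeomorphism. $G$ is then locally compact and locally Hausdorff, but need not be Hausdorff; $G^{(0)}$ is open in $G$. A bisection is an open set $U\subseteq G$ such that $r|_U$ and $s|_U$ are homeomorphisms onto open subsets of $G^{(0)}$. **Upper semicontinuous Banach bundles.** An upper semicontinuous bundle of Banach spaces $p\colon\mathcal{B}\to X$ is a continuous open surjection such that each fibre $\mathcal{B}_x=p^{-1}(x)$ is a complex Banach space, $b\mapsto\|b\|$ is upper semicontinuous on $\mathcal{B}$, scalar multiplication $\mathbb{C}\times\mathcal{B}\to\mathcal{B}$ is continuous, addition is continuous on $\{(b,b')\in\mathcal B\times\mathcal B: p(b)=p(b')\}$, and whenever a net $(b_i)$ satisfies $p(b_i)\to x$ and $\|b_i\|\to 0$, then $b_i\to 0_x\in\mathcal{B}_x$. **Fell bundles.** A Fell bundle over $G$ (not assumed saturated or separable) is an upper semicontinuous bundle of Banach spaces $p\colon\mathcal{A}\to G$ with a continuous multiplication $\mathcal{A}^{(2)}=\{(a,b):(p(a),p(b))\in G^{(2)}\}\to\mathcal{A}$, $(a,b)\mapsto ab$, and a continuous involution $a\mapsto a^*$ on $\mathcal{A}$, such that $p(ab)=p(a)p(b)$; multiplication $\mathcal{A}_{\gamma_1}\times\mathcal{A}_{\gamma_2}\to\mathcal{A}_{\gamma_1\gamma_2}$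 is bilinear for $(\gamma_1,\gamma_2)\in G^{(2)}$; $(ab)c=a(bc)$; $\|ab\|\le\|a\|\|b\|$; $p(a^* )=p(a)^{-1}$; $\mathcal{A}_\gamma\to\mathcal{A}_{\gamma^{-1}}$, $a\mapsto a^*$, is conjugate linear; $(a^* )^*=a$; $(ab)^*=b^*a^*$; $\|a^*a\|=\|aa^*\|=\|a\|^2$; and $a^*a\ge 0$ in the $C^*$-algebra $\mathcal{A}_{s(p(a))}$. (Each fibre $\mathcal{A}_x$, $x\in G^{(0)}$, is a $C^*$-algebra.) Bundles are assumed to have enough sections: through each point of $\mathcal{A}_\gamma$ passes some $f\in C_c(G;\mathcal{A})$. **The $*$-algebra $C_c(G;\mathcal{A})$.** It is the linear span of the sections $f$ of $\mathcal{A}$ for which there is an open Hausdorff set $V\subseteq G$ such that $f|_V$ is continuous with compact support in $V$ and $f=0$ outside $V$. Equivalently it is the span of the spaces $C_c(U;\mathcal{A}|_U)$ (continuous compactly supported sections over $U$, extended by zero) for bisections $U$. Operations: $f*g(\gamma)=\sum_{\alpha\beta=\gamma}f(\alpha)g(\beta)$, $f^*(\gamma)=f(\gamma^{-1})^*$. The inductive limit topology on $C_c(G;\mathcal{A})$ is the inductive limit (locally convex) topology determined by the spaces of continuous sections over bisections $U$ vanishing outside a compact set $K\subseteq U$, each with the sup norm $\|\cdot\|_\infty$. **Representations.** A representation of $C_c(G;\mathcal{A})$ on a Hilbert space $\mathcal{H}$ is a nondegenerate $*$-homomorphism $C_c(G;\mathcal{A})\to\mathbb{B}(\mathcal{H})$;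 continuity in the inductive limit topology is with respect to the norm topology of $\mathbb{B}(\mathcal{H})$. **Pre-representations.** A pre-representation of $C_c(G;\mathcal{A})$ on $\mathcal{H}$ is a pair $(\mathcal{H}_0,L)$ of a linear subspace $\mathcal{H}_0\subseteq\mathcal{H}$ and a homomorphism of complex algebras $L\colon C_c(G;\mathcal{A})\to\mathrm{Lin}(\mathcal{H}_0)$ (all linear maps $\mathcal{H}_0\to\mathcal{H}_0$) such that for all $\xi,\eta\in\mathcal{H}_0$: $f\mapsto\langle\eta,L(f)\xi\rangle$ is continuous in the inductive limit topology; $\langle\eta,L(f)\xi\rangle=\langle L(f^* )\eta,\xi\rangle$ for all $f$; and $\mathcal{H}_{00}=\mathrm{span}\{L(f)\xi:f\in C_c(G;\mathcal{A}),\xi\in\mathcal{H}_0\}$ is dense in $\mathcal{H}$. Inner products are linear in the second variable. *)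

theory Defs
  imports "HOL-Analysis.Analysis" "HOL-Algebra.FiniteProduct"
begin

section \<open>Complex Hilbert spaces\<close>

class complex_inner = real_normed_vector +
  fixes scaleC :: "complex \<Rightarrow> 'a \<Rightarrow> 'a" (infixr \<open>*\<^sub>C\<close> 75)
    and cinner :: "'a \<Rightarrow> 'a \<Rightarrow> complex"
  assumes scaleR_scaleC: "scaleR t x = complex_of_real t *\<^sub>C x"
    and scaleC_add_right: "c *\<^sub>C (x + y) = c *\<^sub>C x + c *\<^sub>C y"
    and scaleC_add_left: "(c + d) *\<^sub>C x = c *\<^sub>C x + d *\<^sub>C x"
    and scaleC_scaleC: "c *\<^sub>C (d *\<^sub>C x) = (c * d) *\<^sub>C x"
    and scaleC_one: "1 *\<^sub>C x = x"
    and cinner_commute: "cinner x y = cnj (cinner y x)"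
    and cinner_add_right: "cinner x (y + z) = cinner x y + cinner x z"
    and cinner_scaleC_right: "cinner x (c *\<^sub>C y) = c * cinner x y"
    and cinner_self_nonneg: "0 \<le> Re (cinner x x)"
    and norm_eq_sqrt_cinner: "norm x = sqrt (Re (cinner x x))"

class complex_hilbert_space = complex_inner + complete_space

global_interpretation complex_vector:
  vector_space "scaleC :: complex \<Rightarrow> 'h \<Rightarrow> 'h :: complex_inner"
  defines csubspace = complex_vector.subspace
    and cspan = complex_vector.span
  by unfold_locales (simp_all add: scaleC_add_right scaleC_add_left scaleC_scaleC scaleC_one)

definition clinear_on :: "'h::complex_inner set \<Rightarrow> ('h \<Rightarrow> 'h) \<Rightarrow> bool" where
  "clinear_on S T \<longleftrightarrow>
     (\<forall>x\<in>S. \<forall>y\<in>S. T (x + y) = T x + T y) \<and> (\<forall>c. \<forall>x\<in>S. T (c *\<^sub>C x) = c *\<^sub>C T x)"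

text \<open>The type \<open>'h \<Rightarrow>\<^sub>L 'h\<close> consists of the bounded real-linear operators, with the operator norm;
  the bounded operators on a complex Hilbert space are those which are complex linear.\<close>

definition bounded_ops :: "('h::complex_inner \<Rightarrow>\<^sub>L 'h) set" where
  "bounded_ops = {T. clinear_on UNIV (blinfun_apply T)}"


section \<open>Etale groupoids\<close>

text \<open>All of the type \<open>'g\<close> is the groupoid; the units are elements of it. The product is only
  meaningful on composable pairs.\<close>

record 'g groupoid_data =
  rng :: "'g \<Rightarrow> 'g"
  src :: "'g \<Rightarrow> 'g"
  gmult :: "'g \<Rightarrow> 'g \<Rightarrow> 'g"
  ginv :: "'g \<Rightarrow> 'g"

definition units :: "'g groupoid_data \<Rightarrow> 'g set" where
  "units G = range (src G)"

definition composable :: "'g groupoid_data \<Rightarrow> ('g \<times> 'g) set" where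
  "composable G = {(\<alpha>, \<beta>). src G \<alpha> = rng G \<beta>}"

locale topological_groupoid =
  fixes G :: "'g::topological_space groupoid_data"
  assumes rng_rng: "rng G (rng G \<gamma>) = rng G \<gamma>"
    and src_rng: "src G (rng G \<gamma>) = rng G \<gamma>"
    and rng_src: "rng G (src G \<gamma>) = src G \<gamma>"
    and src_src: "src G (src G \<gamma>) = src G \<gamma>"
    and rng_mult: "src G \<alpha> = rng G \<beta> \<Longrightarrow> rng G (gmult G \<alpha> \<beta>) = rng G \<alpha>"
    and src_mult: "src G \<alpha> = rng G \<beta> \<Longrightarrow> src G (gmult G \<alpha> \<beta>) = src G \<beta>"
    and mult_assoc: "src G \<alpha> = rng G \<beta> \<Longrightarrow> src G \<beta> = rng G \<gamma> \<Longrightarrow>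
           gmult G (gmult G \<alpha> \<beta>) \<gamma> = gmult G \<alpha> (gmult G \<beta> \<gamma>)"
    and rng_left_unit: "gmult G (rng G \<gamma>) \<gamma> = \<gamma>"
    and src_right_unit: "gmult G \<gamma> (src G \<gamma>) = \<gamma>"
    and rng_inv: "rng G (ginv G \<gamma>) = src G \<gamma>"
    and src_inv: "src G (ginv G \<gamma>) = rng G \<gamma>"
    and mult_inv_right: "gmult G \<gamma> (ginv G \<gamma>) = rng G \<gamma>"
    and mult_inv_left: "gmult G (ginv G \<gamma>) \<gamma> = src G \<gamma>"
    and continuous_mult: "continuous_on (composable G) (\<lambda>(\<alpha>, \<beta>). gmult G \<alpha> \<beta>)"
    and continuous_inv: "continuous_on UNIV (ginv G)"

definition homeo_onto_open_of_units :: "'g::topological_space groupoid_data \<Rightarrow> 'g set \<Rightarrow> ('g \<Rightarrow> 'g) \<Rightarrow> bool"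
  where
  "homeo_onto_open_of_units G U f \<longleftrightarrow>
     openin (top_of_set (units G)) (f ` U) \<and>
     homeomorphic_map (top_of_set U) (top_of_set (f ` U)) f"

locale etale_groupoid = topological_groupoid +
  assumes units_locally_compact: "locally_compact_space (top_of_set (units G))"
    and units_Hausdorff: "Hausdorff_space (top_of_set (units G))"
    and rng_local_homeomorphism:
      "\<exists>U. open U \<and> \<gamma> \<in> U \<and> homeo_onto_open_of_units G U (rng G)"

definition bisection :: "'g::topological_space groupoid_data \<Rightarrow> 'g set \<Rightarrow> bool" where
  "bisection G U \<longleftrightarrow>
     open U \<and> homeo_onto_open_of_units G U (rng G) \<and> homeo_onto_open_of_units G U (src G)"


section \<open>Upper semicontinuous Banach bundles\<close>

text \<open>All of the type \<open>'a\<close> is the total space. Addition is only meaningful within a fibre.\<close>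

record ('g, 'a) banach_bundle_data =
  proj :: "'a \<Rightarrow> 'g"
  badd :: "'a \<Rightarrow> 'a \<Rightarrow> 'a"
  bzero :: "'g \<Rightarrow> 'a"
  bscale :: "complex \<Rightarrow> 'a \<Rightarrow> 'a"
  bnorm :: "'a \<Rightarrow> real"

text \<open>The additive group of the fibre over \<open>x\<close>, written in the multiplicative notation
  of \<^theory>\<open>HOL-Algebra.Group\<close>, so that \<^const>\<open>finprod\<close> is the finite sum in the fibre.\<close>

definition fibre_group :: "('g, 'a, 'm) banach_bundle_data_scheme \<Rightarrow> 'g \<Rightarrow> 'a monoid" where
  "fibre_group A x = \<lparr>carrier = {a. proj A a = x}, monoid.mult = badd A, one = bzero A x\<rparr>"

definition bminus :: "('g, 'a, 'm) banach_bundle_data_scheme \<Rightarrow> 'a \<Rightarrow> 'a \<Rightarrow> 'a" where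
  "bminus A a b = badd A a (bscale A (- 1) b)"

locale usc_banach_bundle =
  fixes A :: "('g::topological_space, 'a::topological_space, 'm) banach_bundle_data_scheme"
  assumes proj_continuous: "continuous_on UNIV (proj A)"
    and proj_open: "open W \<Longrightarrow> open (proj A ` W)"
    and proj_surj: "surj (proj A)"
    and fibre_comm_group: "comm_group (fibre_group A x)"
    and proj_scale: "proj A (bscale A c a) = proj A a"
    and scale_add_right: "proj A a = proj A b \<Longrightarrow>
           bscale A c (badd A a b) = badd A (bscale A c a) (bscale A c b)"
    and scale_add_left: "bscale A (c + d) a = badd A (bscale A c a) (bscale A d a)"
    and scale_scale: "bscale A c (bscale A d a) = bscale A (c * d) a"
    and scale_one: "bscale A 1 a = a"
    and norm_nonneg: "0 \<le> bnorm A a"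
    and norm_eq_0_iff: "bnorm A a = 0 \<longleftrightarrow> a = bzero A (proj A a)"
    and norm_triangle: "proj A a = proj A b \<Longrightarrow> bnorm A (badd A a b) \<le> bnorm A a + bnorm A b"
    and norm_scale: "bnorm A (bscale A c a) = cmod c * bnorm A a"
    and fibre_complete: "(\<And>n. proj A (u n) = x) \<Longrightarrow>
           (\<And>e. e > 0 \<Longrightarrow> \<exists>N::nat. \<forall>m\<ge>N. \<forall>n\<ge>N. bnorm A (bminus A (u m) (u n)) < e) \<Longrightarrow>
           \<exists>l. proj A l = x \<and> (\<lambda>n. bnorm A (bminus A (u n) l)) \<longlonglongrightarrow> 0"
    and norm_upper_semicontinuous: "open {a. bnorm A a < e}"
    and scale_continuous: "continuous_on UNIV (\<lambda>(c, a). bscale A c a)"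
    and add_continuous:
      "continuous_on {(a, b). proj A a = proj A b} (\<lambda>(a, b). badd A a b)"
    \<comment> \<open>A net in the total space is represented by its filter of eventual sets.\<close>
    and norm_to_0: "(proj A \<longlongrightarrow> x) F \<Longrightarrow> (bnorm A \<longlongrightarrow> 0) F \<Longrightarrow> ((\<lambda>a. a) \<longlongrightarrow> bzero A x) F"

definition is_section :: "('g, 'a, 'm) banach_bundle_data_scheme \<Rightarrow> ('g \<Rightarrow> 'a) \<Rightarrow> bool" where
  "is_section A f \<longleftrightarrow> (\<forall>\<gamma>. proj A (f \<gamma>) = \<gamma>)"

definition sec_add ::
  "('g, 'a, 'm) banach_bundle_data_scheme \<Rightarrow> ('g \<Rightarrow> 'a) \<Rightarrow> ('g \<Rightarrow> 'a) \<Rightarrow> 'g \<Rightarrow> 'a" where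
  "sec_add A f g = (\<lambda>\<gamma>. badd A (f \<gamma>) (g \<gamma>))"

definition sec_scale ::
  "('g, 'a, 'm) banach_bundle_data_scheme \<Rightarrow> complex \<Rightarrow> ('g \<Rightarrow> 'a) \<Rightarrow> 'g \<Rightarrow> 'a" where
  "sec_scale A c f = (\<lambda>\<gamma>. bscale A c (f \<gamma>))"

definition sec_subspace :: "('g, 'a, 'm) banach_bundle_data_scheme \<Rightarrow> ('g \<Rightarrow> 'a) set \<Rightarrow> bool" where
  "sec_subspace A S \<longleftrightarrow>
     bzero A \<in> S \<and> (\<forall>f\<in>S. \<forall>g\<in>S. sec_add A f g \<in> S) \<and> (\<forall>c. \<forall>f\<in>S. sec_scale A c f \<in> S)"

definition support_in ::
  "('g::topological_space, 'a, 'm) banach_bundle_data_scheme \<Rightarrow> 'g set \<Rightarrow> ('g \<Rightarrow> 'a) \<Rightarrow> 'g set" where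
  "support_in A V f = top_of_set V closure_of {\<gamma> \<in> V. f \<gamma> \<noteq> bzero A \<gamma>}"

text \<open>The linear span of the sections that are continuous with compact support on some
  open Hausdorff set and zero outside it; such a section need not be continuous on the whole
  space.\<close>

definition Cc ::
  "('g::topological_space, 'a::topological_space, 'm) banach_bundle_data_scheme \<Rightarrow> ('g \<Rightarrow> 'a) set" where
  "Cc A = sec_subspace A hull
     {f. is_section A f \<and>
         (\<exists>V. open V \<and> Hausdorff_space (top_of_set V) \<and> continuous_on V f \<and>
              compact (support_in A V f) \<and> (\<forall>\<gamma>. \<gamma> \<notin> V \<longrightarrow> f \<gamma> = bzero A \<gamma>))}"


section \<open>Fell bundles\<close>

record ('g, 'a) fell_bundle_data = "('g, 'a) banach_bundle_data" +
  fmult :: "'a \<Rightarrow> 'a \<Rightarrow> 'a"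
  fstar :: "'a \<Rightarrow> 'a"

text \<open>For a unit \<open>x\<close>, the fibre over \<open>x\<close> is an algebra, possibly without identity. Its unitization
  consists of the pairs \<open>(a, l)\<close>, standing for \<open>a + l1\<close>.\<close>

definition unitization_mult ::
  "('g, 'a, 'm) fell_bundle_data_scheme \<Rightarrow> 'a \<times> complex \<Rightarrow> 'a \<times> complex \<Rightarrow> 'a \<times> complex" where
  "unitization_mult A = (\<lambda>(a, l) (b, m).
     (badd A (fmult A a b) (badd A (bscale A m a) (bscale A l b)), l * m))"

definition fibre_spectrum :: "('g, 'a, 'm) fell_bundle_data_scheme \<Rightarrow> 'g \<Rightarrow> 'a \<Rightarrow> complex set" where
  "fibre_spectrum A x a = {l. \<not> (\<exists>b m. proj A b = x \<and>
      unitization_mult A (a, - l) (b, m) = (bzero A x, 1) \<and>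
      unitization_mult A (b, m) (a, - l) = (bzero A x, 1))}"

definition fibre_positive :: "('g, 'a, 'm) fell_bundle_data_scheme \<Rightarrow> 'g \<Rightarrow> 'a \<Rightarrow> bool" where
  "fibre_positive A x a \<longleftrightarrow>
     proj A a = x \<and> fstar A a = a \<and> fibre_spectrum A x a \<subseteq> {complex_of_real t | t. 0 \<le> t}"

locale fell_bundle = topological_groupoid G + usc_banach_bundle A
  for G :: "'g::topological_space groupoid_data"
    and A :: "('g, 'a::topological_space, 'm) fell_bundle_data_scheme" +
  assumes fmult_continuous:
      "continuous_on {(a, b). (proj A a, proj A b) \<in> composable G} (\<lambda>(a, b). fmult A a b)"
    and fstar_continuous: "continuous_on UNIV (fstar A)"
    and proj_fmult: "(proj A a, proj A b) \<in> composable G \<Longrightarrow>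
           proj A (fmult A a b) = gmult G (proj A a) (proj A b)"
    and fmult_add_left: "proj A a = proj A a' \<Longrightarrow> (proj A a, proj A b) \<in> composable G \<Longrightarrow>
           fmult A (badd A a a') b = badd A (fmult A a b) (fmult A a' b)"
    and fmult_add_right: "proj A b = proj A b' \<Longrightarrow> (proj A a, proj A b) \<in> composable G \<Longrightarrow>
           fmult A a (badd A b b') = badd A (fmult A a b) (fmult A a b')"
    and fmult_scale_left: "(proj A a, proj A b) \<in> composable G \<Longrightarrow>
           fmult A (bscale A c a) b = bscale A c (fmult A a b)"
    and fmult_scale_right: "(proj A a, proj A b) \<in> composable G \<Longrightarrow>
           fmult A a (bscale A c b) = bscale A c (fmult A a b)"
    and fmult_assoc: "(proj A a, proj A b) \<in> composable G \<Longrightarrow>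
           (proj A b, proj A d) \<in> composable G \<Longrightarrow>
           fmult A (fmult A a b) d = fmult A a (fmult A b d)"
    and norm_fmult: "(proj A a, proj A b) \<in> composable G \<Longrightarrow>
           bnorm A (fmult A a b) \<le> bnorm A a * bnorm A b"
    and proj_fstar: "proj A (fstar A a) = ginv G (proj A a)"
    and fstar_add: "proj A a = proj A b \<Longrightarrow> fstar A (badd A a b) = badd A (fstar A a) (fstar A b)"
    and fstar_scale: "fstar A (bscale A c a) = bscale A (cnj c) (fstar A a)"
    and fstar_fstar: "fstar A (fstar A a) = a"
    and fstar_fmult: "(proj A a, proj A b) \<in> composable G \<Longrightarrow>
           fstar A (fmult A a b) = fmult A (fstar A b) (fstar A a)"
    and norm_fstar_fmult: "bnorm A (fmult A (fstar A a) a) = (bnorm A a)\<^sup>2"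
    and norm_fmult_fstar: "bnorm A (fmult A a (fstar A a)) = (bnorm A a)\<^sup>2"
    and fstar_fmult_positive: "fibre_positive A (src G (proj A a)) (fmult A (fstar A a) a)"
    and enough_sections: "\<exists>f\<in>Cc A. f (proj A a) = a"


section \<open>The convolution algebra\<close>

text \<open>The sum of \<open>f \<alpha> g \<beta>\<close> over all factorizations \<open>\<gamma> = \<alpha>\<beta>\<close>, in the fibre over \<open>\<gamma>\<close>. The index set
  omits the vanishing summands, which leaves finitely many when \<open>f\<close> and \<open>g\<close> are in \<^const>\<open>Cc\<close>.\<close>

definition conv ::
  "'g groupoid_data \<Rightarrow> ('g, 'a, 'm) fell_bundle_data_scheme \<Rightarrow> ('g \<Rightarrow> 'a) \<Rightarrow> ('g \<Rightarrow> 'a) \<Rightarrow> 'g \<Rightarrow> 'a" where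
  "conv G A f g = (\<lambda>\<gamma>. finprod (fibre_group A \<gamma>) (\<lambda>(\<alpha>, \<beta>). fmult A (f \<alpha>) (g \<beta>))
     {(\<alpha>, \<beta>) \<in> composable G. gmult G \<alpha> \<beta> = \<gamma> \<and> fmult A (f \<alpha>) (g \<beta>) \<noteq> bzero A \<gamma>})"

definition sec_star ::
  "'g groupoid_data \<Rightarrow> ('g, 'a, 'm) fell_bundle_data_scheme \<Rightarrow> ('g \<Rightarrow> 'a) \<Rightarrow> 'g \<Rightarrow> 'a" where
  "sec_star G A f = (\<lambda>\<gamma>. fstar A (f (ginv G \<gamma>)))"


section \<open>The inductive limit topology\<close>

definition sup_norm :: "('g, 'a, 'm) banach_bundle_data_scheme \<Rightarrow> ('g \<Rightarrow> 'a) \<Rightarrow> real" where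
  "sup_norm A f = (SUP \<gamma>. bnorm A (f \<gamma>))"

definition sections_on ::
  "('g::topological_space, 'a::topological_space, 'm) banach_bundle_data_scheme \<Rightarrow> 'g set \<Rightarrow> 'g set
     \<Rightarrow> ('g \<Rightarrow> 'a) set" where
  "sections_on A U K =
     {f. is_section A f \<and> continuous_on U f \<and> (\<forall>\<gamma>. \<gamma> \<notin> K \<longrightarrow> f \<gamma> = bzero A \<gamma>)}"

text \<open>The finest locally convex topology making all inclusions of the normed spaces
  \<open>sections_on A U K\<close> continuous: its basic neighbourhoods of zero are the convex, balanced and
  absorbing subsets whose trace on each of these spaces is a neighbourhood of zero there.\<close>

definition zero_nhd ::
  "'g::topological_space groupoid_data \<Rightarrow> ('g, 'a::topological_space, 'm) banach_bundle_data_scheme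
     \<Rightarrow> ('g \<Rightarrow> 'a) set \<Rightarrow> bool" where
  "zero_nhd G A N \<longleftrightarrow>
     N \<subseteq> Cc A \<and>
     (\<forall>f\<in>N. \<forall>g\<in>N. \<forall>t::real. 0 \<le> t \<and> t \<le> 1 \<longrightarrow>
        sec_add A (sec_scale A (of_real t) f) (sec_scale A (of_real (1 - t)) g) \<in> N) \<and>
     (\<forall>f\<in>N. \<forall>c. cmod c \<le> 1 \<longrightarrow> sec_scale A c f \<in> N) \<and>
     (\<forall>f\<in>Cc A. \<exists>t::real. t > 0 \<and> sec_scale A (of_real t) f \<in> N) \<and>
     (\<forall>U K. bisection G U \<and> compact K \<and> K \<subseteq> U \<longrightarrow>
        (\<exists>e>0. \<forall>f\<in>sections_on A U K. sup_norm A f < e \<longrightarrow> f \<in> N))"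

definition ind_limit_topology ::
  "'g::topological_space groupoid_data \<Rightarrow> ('g, 'a::topological_space, 'm) banach_bundle_data_scheme
     \<Rightarrow> ('g \<Rightarrow> 'a) topology" where
  "ind_limit_topology G A = topology (\<lambda>W. W \<subseteq> Cc A \<and>
     (\<forall>f\<in>W. \<exists>N. zero_nhd G A N \<and> (\<forall>g\<in>N. sec_add A f g \<in> W)))"

lemma zero_nhd_subset: "zero_nhd G A N \<Longrightarrow> N \<subseteq> Cc A"
  by (simp add: zero_nhd_def)

lemma zero_nhd_convex:
  "zero_nhd G A N \<Longrightarrow> f \<in> N \<Longrightarrow> g \<in> N \<Longrightarrow> 0 \<le> t \<Longrightarrow> t \<le> 1 \<Longrightarrow>
     sec_add A (sec_scale A (of_real t) f) (sec_scale A (of_real (1 - t)) g) \<in> N"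
  by (simp add: zero_nhd_def)

lemma zero_nhd_balanced: "zero_nhd G A N \<Longrightarrow> f \<in> N \<Longrightarrow> cmod c \<le> 1 \<Longrightarrow> sec_scale A c f \<in> N"
  by (simp add: zero_nhd_def)

lemma zero_nhd_absorbing:
  "zero_nhd G A N \<Longrightarrow> f \<in> Cc A \<Longrightarrow> \<exists>t::real. t > 0 \<and> sec_scale A (of_real t) f \<in> N"
  by (simp add: zero_nhd_def)

lemma zero_nhd_trace:
  "zero_nhd G A N \<Longrightarrow> bisection G U \<and> compact K \<and> K \<subseteq> U \<Longrightarrow>
     \<exists>e>0. \<forall>f\<in>sections_on A U K. sup_norm A f < e \<longrightarrow> f \<in> N"
  by (simp add: zero_nhd_def)

context usc_banach_bundle
begin

lemma zero_nhd_scale: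
  assumes N: "zero_nhd G A N" and f: "sec_scale A (of_real u) f \<in> N" and m: "0 < m" "m \<le> u"
  shows "sec_scale A (complex_of_real m) f \<in> N"
proof -
  have "cmod (of_real (m / u)) \<le> 1"
    using m by (simp only: norm_of_real) simp
  then have "sec_scale A (of_real (m / u)) (sec_scale A (of_real u) f) \<in> N"
    by (rule zero_nhd_balanced[OF N f])
  moreover have "complex_of_real (m / u) * of_real u = of_real m"
    using m by simp
  ultimately show ?thesis
    by (simp only: sec_scale_def scale_scale)
qed

lemma zero_nhd_Int:
  assumes N: "zero_nhd G A N" and N': "zero_nhd G A N'"
  shows "zero_nhd G A (N \<inter> N')"
proof -
  have "\<exists>t::real. t > 0 \<and> sec_scale A (of_real t) f \<in> N \<inter> N'" if f: "f \<in> Cc A" for f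
  proof -
    obtain t :: real where t: "t > 0" "sec_scale A (of_real t) f \<in> N"
      using zero_nhd_absorbing[OF N f] by (elim exE conjE)
    obtain t' :: real where t': "t' > 0" "sec_scale A (of_real t') f \<in> N'"
      using zero_nhd_absorbing[OF N' f] by (elim exE conjE)
    have m: "min t t' > 0"
      using t t' by simp
    show ?thesis
      using zero_nhd_scale[OF N t(2) m] zero_nhd_scale[OF N' t'(2) m] m
      by (intro exI[of _ "min t t'"]) simp
  qed
  then have absorbing: "\<forall>f\<in>Cc A. \<exists>t::real. t > 0 \<and> sec_scale A (of_real t) f \<in> N \<inter> N'"
    by (rule ballI)
  have convex: "sec_add A (sec_scale A (of_real t) f) (sec_scale A (of_real (1 - t)) g) \<in> N \<inter> N'"
    if "f \<in> N \<inter> N'" "g \<in> N \<inter> N'" "0 \<le> t \<and> t \<le> 1" for f g and t :: real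
  proof (rule IntI)
    show "sec_add A (sec_scale A (of_real t) f) (sec_scale A (of_real (1 - t)) g) \<in> N"
      using zero_nhd_convex[OF N, of f g t] that by simp
    show "sec_add A (sec_scale A (of_real t) f) (sec_scale A (of_real (1 - t)) g) \<in> N'"
      using zero_nhd_convex[OF N', of f g t] that by simp
  qed
  have balanced: "sec_scale A c f \<in> N \<inter> N'" if "f \<in> N \<inter> N'" "cmod c \<le> 1" for f c
    using zero_nhd_balanced[OF N, of f c] zero_nhd_balanced[OF N', of f c] that by simp
  have trace: "\<exists>e>0. \<forall>f\<in>sections_on A U K. sup_norm A f < e \<longrightarrow> f \<in> N \<inter> N'"
    if *: "bisection G U \<and> compact K \<and> K \<subseteq> U" for U K
  proof -
    obtain e where e: "e > 0" "\<forall>f\<in>sections_on A U K. sup_norm A f < e \<longrightarrow> f \<in> N"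
      using zero_nhd_trace[OF N *] by (elim exE conjE)
    obtain e' where e': "e' > 0" "\<forall>f\<in>sections_on A U K. sup_norm A f < e' \<longrightarrow> f \<in> N'"
      using zero_nhd_trace[OF N' *] by (elim exE conjE)
    show ?thesis
      using e e' by (intro exI[of _ "min e e'"]) simp
  qed
  show ?thesis
    unfolding zero_nhd_def[of G A "N \<inter> N'"]
  proof (intro conjI)
    show "N \<inter> N' \<subseteq> Cc A"
      using zero_nhd_subset[OF N] by (rule le_infI1)
    show "\<forall>f\<in>N \<inter> N'. \<forall>g\<in>N \<inter> N'. \<forall>t::real. 0 \<le> t \<and> t \<le> 1 \<longrightarrow>
        sec_add A (sec_scale A (of_real t) f) (sec_scale A (of_real (1 - t)) g) \<in> N \<inter> N'"
      by (intro ballI allI impI convex)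
    show "\<forall>f\<in>N \<inter> N'. \<forall>c. cmod c \<le> 1 \<longrightarrow> sec_scale A c f \<in> N \<inter> N'"
      by (intro ballI allI impI balanced)
    show "\<forall>f\<in>Cc A. \<exists>t::real. t > 0 \<and> sec_scale A (of_real t) f \<in> N \<inter> N'"
      by (rule absorbing)
    show "\<forall>U K. bisection G U \<and> compact K \<and> K \<subseteq> U \<longrightarrow>
        (\<exists>e>0. \<forall>f\<in>sections_on A U K. sup_norm A f < e \<longrightarrow> f \<in> N \<inter> N')"
      by (intro allI impI trace)
  qed
qed

lemma openin_ind_limit_topology:
  "openin (ind_limit_topology G A) W \<longleftrightarrow>
     W \<subseteq> Cc A \<and> (\<forall>f\<in>W. \<exists>N. zero_nhd G A N \<and> (\<forall>g\<in>N. sec_add A f g \<in> W))"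
proof -
  define P where "P W f \<longleftrightarrow> (\<exists>N. zero_nhd G A N \<and> (\<forall>g\<in>N. sec_add A f g \<in> W))" for W f
  have Int: "P (S \<inter> T) f" if PS: "P S f" and PT: "P T f" for S T f
  proof -
    obtain N where N: "zero_nhd G A N" "\<forall>g\<in>N. sec_add A f g \<in> S"
      using PS unfolding P_def by blast
    obtain N' where N': "zero_nhd G A N'" "\<forall>g\<in>N'. sec_add A f g \<in> T"
      using PT unfolding P_def by blast
    show ?thesis
      unfolding P_def using zero_nhd_Int[OF N(1) N'(1)] N(2) N'(2)
      by (intro exI[of _ "N \<inter> N'"]) simp
  qed
  have mono: "P T f" if "P S f" "S \<subseteq> T" for S T f
    using that unfolding P_def by blast
  have "istopology (\<lambda>W. W \<subseteq> Cc A \<and> (\<forall>f\<in>W. P W f))"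
    unfolding istopology_def
  proof (intro conjI allI impI)
    fix S T
    assume "S \<subseteq> Cc A \<and> (\<forall>f\<in>S. P S f)" "T \<subseteq> Cc A \<and> (\<forall>f\<in>T. P T f)"
    then show "S \<inter> T \<subseteq> Cc A" "\<forall>f\<in>S \<inter> T. P (S \<inter> T) f"
      using Int by auto
  next
    fix \<K>
    assume K: "\<forall>W\<in>\<K>. W \<subseteq> Cc A \<and> (\<forall>f\<in>W. P W f)"
    then show "\<Union>\<K> \<subseteq> Cc A"
      by auto
    show "\<forall>f\<in>\<Union>\<K>. P (\<Union>\<K>) f"
    proof
      fix f assume "f \<in> \<Union>\<K>"
      then obtain W where W: "W \<in> \<K>" "f \<in> W" by auto
      then have "P W f" using K by simp
      then show "P (\<Union>\<K>) f" using mono Union_upper[OF W(1)] by simp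
    qed
  qed
  then show ?thesis
    unfolding ind_limit_topology_def P_def by (simp only: topology_inverse')
qed

end


section \<open>Representations and pre-representations\<close>

locale cc_representation = fell_bundle G A
  for G :: "'g::topological_space groupoid_data"
    and A :: "('g, 'a::topological_space, 'm) fell_bundle_data_scheme" +
  fixes M :: "('g \<Rightarrow> 'a) \<Rightarrow> 'h::complex_hilbert_space \<Rightarrow>\<^sub>L 'h"
  assumes rep_bounded_ops: "f \<in> Cc A \<Longrightarrow> M f \<in> bounded_ops"
    and rep_add: "f \<in> Cc A \<Longrightarrow> g \<in> Cc A \<Longrightarrow> M (sec_add A f g) = M f + M g"
    and rep_scale: "f \<in> Cc A \<Longrightarrow> M (sec_scale A c f) \<xi> = c *\<^sub>C M f \<xi>"
    and rep_conv: "f \<in> Cc A \<Longrightarrow> g \<in> Cc A \<Longrightarrow> M (conv G A f g) = M f o\<^sub>L M g"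
    and rep_star: "f \<in> Cc A \<Longrightarrow> cinner \<eta> (M f \<xi>) = cinner (M (sec_star G A f) \<eta>) \<xi>"
    and rep_nondegenerate: "closure (cspan {M f \<xi> | f \<xi>. f \<in> Cc A}) = UNIV"

definition H00 ::
  "('g::topological_space, 'a::topological_space, 'm) fell_bundle_data_scheme \<Rightarrow>
     'h::complex_hilbert_space set \<Rightarrow> (('g \<Rightarrow> 'a) \<Rightarrow> 'h \<Rightarrow> 'h) \<Rightarrow> 'h set" where
  "H00 A H0 L = cspan {L f \<xi> | f \<xi>. f \<in> Cc A \<and> \<xi> \<in> H0}"

text \<open>Only the values of \<open>L f\<close> on \<open>H0\<close> for \<open>f \<in> Cc A\<close> are relevant.\<close>

locale pre_representation = fell_bundle G A
  for G :: "'g::topological_space groupoid_data"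
    and A :: "('g, 'a::topological_space, 'm) fell_bundle_data_scheme" +
  fixes H0 :: "'h::complex_hilbert_space set"
    and L :: "('g \<Rightarrow> 'a) \<Rightarrow> 'h \<Rightarrow> 'h"
  assumes H0_subspace: "csubspace H0"
    and L_maps: "f \<in> Cc A \<Longrightarrow> \<xi> \<in> H0 \<Longrightarrow> L f \<xi> \<in> H0"
    and L_linear: "f \<in> Cc A \<Longrightarrow> clinear_on H0 (L f)"
    and L_add: "f \<in> Cc A \<Longrightarrow> g \<in> Cc A \<Longrightarrow> \<xi> \<in> H0 \<Longrightarrow> L (sec_add A f g) \<xi> = L f \<xi> + L g \<xi>"
    and L_scale: "f \<in> Cc A \<Longrightarrow> \<xi> \<in> H0 \<Longrightarrow> L (sec_scale A c f) \<xi> = c *\<^sub>C L f \<xi>"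
    and L_conv: "f \<in> Cc A \<Longrightarrow> g \<in> Cc A \<Longrightarrow> \<xi> \<in> H0 \<Longrightarrow> L (conv G A f g) \<xi> = L f (L g \<xi>)"
    and L_continuous: "\<xi> \<in> H0 \<Longrightarrow> \<eta> \<in> H0 \<Longrightarrow>
           continuous_map (ind_limit_topology G A) euclidean (\<lambda>f. cinner \<eta> (L f \<xi>))"
    and L_star: "f \<in> Cc A \<Longrightarrow> \<xi> \<in> H0 \<Longrightarrow> \<eta> \<in> H0 \<Longrightarrow>
           cinner \<eta> (L f \<xi>) = cinner (L (sec_star G A f) \<eta>) \<xi>"
    and H00_dense: "closure (H00 A H0 L) = UNIV"

end

theory Submission
  imports Defs
begin

text \<open>
  Everything follows from one estimate: if \<open>f\<close> is a section with compact support \<open>K\<close> in a bisection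
  \<open>U\<close> and \<open>\<parallel>f\<parallel> \<le> s\<close>, then \<open>\<parallel>L(f)\<xi>\<parallel> \<le> s \<parallel>\<xi>\<parallel>\<close> for all \<open>\<xi>\<close> in \<open>H0\<close> (\<open>norm_L_le\<close>). Its proof is the
  spectral radius argument that shows that \<open>*\<close>-homomorphisms into \<open>C\<^sup>*\<close>-algebras are contractive,
  with the continuity of \<open>f \<mapsto> \<langle>\<xi>, L(f)\<xi>\<rangle>\<close> in place of a Banach algebra norm. Put \<open>f\<^sub>0 = f\<close> and
  \<open>f\<^sub>n\<^sub>+\<^sub>1 = f\<^sub>n\<^sup>* * f\<^sub>n\<close>. Since \<open>U\<close> is a bisection, \<open>f\<^sup>* * f\<close> is the section \<open>s(\<beta>) \<mapsto> f(\<beta>)\<^sup>* f(\<beta>)\<close> over the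
  open set \<open>s(U)\<close> of units; so all \<open>f\<^sub>n\<close> with \<open>n > 0\<close> are sections over \<open>s(U)\<close> that vanish outside
  the compact set \<open>s(K)\<close>, and \<open>\<parallel>f\<^sub>n\<parallel> \<le> s\<^bsup>2^n\<^esup>\<close>. The identity
  \<open>\<parallel>L(f\<^sub>n)\<xi>\<parallel>\<^sup>2 = \<bar>\<langle>\<xi>, L(f\<^sub>n\<^sub>+\<^sub>1)\<xi>\<rangle>\<bar>\<close> and the Cauchy--Schwarz inequality give
  \<open>\<parallel>L(f\<^sub>n)\<xi>\<parallel>\<^sup>2 \<le> \<parallel>\<xi>\<parallel> \<parallel>L(f\<^sub>n\<^sub>+\<^sub>1)\<xi>\<parallel>\<close>, whereas continuity gives
  \<open>\<parallel>L(f\<^sub>n)\<xi>\<parallel>\<^sup>2 \<le> C s\<^bsup>2^(n+1)\<^esup>\<close> with \<open>C\<close> independent of \<open>n\<close>. The two are compatible for all \<open>n\<close> only if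
  \<open>\<parallel>L(f)\<xi>\<parallel> \<le> s \<parallel>\<xi>\<parallel>\<close>.

  Sections supported in bisections span \<^const>\<open>Cc\<close>
  (\<open>Cc_subset_if_contains_bisection_sections\<close>), so \<open>L(h)\<close> is bounded on \<open>H0\<close> for every \<open>h\<close>, and its
  continuous extension is \<open>M(h)\<close>. The algebraic identities of \<open>M\<close> hold on the dense subspace \<open>H0\<close>,
  hence everywhere, and the estimate says that \<open>M\<close> is contractive on each of the normed spaces that
  define the inductive limit topology, hence continuous. Finally \<open>M'(h)\<close> is the restriction of
  \<open>M(h)\<close> to \<open>H00\<close>, since \<open>L(h * f)\<xi> = L(h)L(f)\<xi>\<close>.
\<close>

section \<open>Complex inner product spaces\<close>

context complex_inner
begin

lemma cinner_add_left: "cinner (x + y) z = cinner x z + cinner y z"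
  by (metis cinner_add_right cinner_commute complex_cnj_add)

lemma cinner_scaleC_left: "cinner (c *\<^sub>C x) y = cnj c * cinner x y"
  by (metis cinner_scaleC_right cinner_commute complex_cnj_mult)

lemma cinner_self: "cinner x x = complex_of_real ((norm x)\<^sup>2)"
proof -
  have "cinner x x \<in> \<real>"
    by (metis cinner_commute Reals_cnj_iff)
  then have "cinner x x = complex_of_real (Re (cinner x x))"
    by (simp add: complex_is_Real_iff complex_eq_iff)
  then show ?thesis
    using norm_eq_sqrt_cinner[of x] cinner_self_nonneg[of x] by simp
qed

lemma norm_scaleC: "norm (c *\<^sub>C x) = cmod c * norm x"
proof -
  have "complex_of_real ((norm (c *\<^sub>C x))\<^sup>2) = c * cnj c * complex_of_real ((norm x)\<^sup>2)"
    by (metis cinner_self cinner_scaleC_left cinner_scaleC_right mult.assoc mult.commute)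
  also have "\<dots> = complex_of_real ((cmod c * norm x)\<^sup>2)"
    by (simp add: complex_mult_cnj cmod_power2 power_mult_distrib)
  finally have "(norm (c *\<^sub>C x))\<^sup>2 = (cmod c * norm x)\<^sup>2"
    by (simp only: of_real_eq_iff)
  then show ?thesis
    by (simp add: power2_eq_iff_nonneg)
qed

text \<open>The Cauchy--Schwarz inequality: the vector \<open>y - t\<langle>x,y\<rangle>x\<close> has nonnegative norm for every
  real \<open>t\<close>; take \<open>t = 1/\<parallel>x\<parallel>\<^sup>2\<close>.\<close>

lemma norm_cinner_le: "cmod (cinner x y) \<le> norm x * norm y"
proof (cases "x = 0")
  case True
  have "cinner 0 y = 0"
    using cinner_add_left[of 0 0 y] by simp
  then show ?thesis using True by simp
next
  case False
  define a where "a = cinner x y"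
  define t where "t = 1 / (norm x)\<^sup>2"
  define b where "b = - complex_of_real t * a"
  have yx: "cinner y x = cnj a"
    by (simp add: a_def) (rule cinner_commute)
  have aa: "a * cnj a = complex_of_real ((cmod a)\<^sup>2)"
    by (simp add: complex_mult_cnj cmod_power2)
  have nx: "(norm x)\<^sup>2 > 0"
    using False by simp
  have "cinner (y + b *\<^sub>C x) (y + b *\<^sub>C x) =
      complex_of_real ((norm y)\<^sup>2) + b * cnj a + cnj b * a + b * cnj b * complex_of_real ((norm x)\<^sup>2)"
    by (simp add: cinner_add_left cinner_add_right cinner_scaleC_left cinner_scaleC_right yx
        cinner_self[of x] cinner_self[of y] algebra_simps flip: a_def)
  also have "\<dots> = complex_of_real ((norm y)\<^sup>2) - 2 * complex_of_real t * (a * cnj a)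
      + complex_of_real t * complex_of_real t * (a * cnj a) * complex_of_real ((norm x)\<^sup>2)"
    by (simp add: b_def algebra_simps)
  also have "\<dots> = complex_of_real ((norm y)\<^sup>2 - 2 * t * (cmod a)\<^sup>2 + t * t * (cmod a)\<^sup>2 * (norm x)\<^sup>2)"
    unfolding aa by simp
  finally have "0 \<le> (norm y)\<^sup>2 - 2 * t * (cmod a)\<^sup>2 + t * t * (cmod a)\<^sup>2 * (norm x)\<^sup>2"
    by (metis cinner_self_nonneg Re_complex_of_real)
  also have "t * t * (cmod a)\<^sup>2 * (norm x)\<^sup>2 = t * (cmod a)\<^sup>2"
    using nx by (simp add: t_def power2_eq_square)
  finally have "(cmod a)\<^sup>2 \<le> (norm x * norm y)\<^sup>2"
    using nx by (simp add: t_def field_simps power_mult_distrib)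
  then show ?thesis
    unfolding a_def by (rule power2_le_imp_le) simp
qed

end

lemma bounded_bilinear_cinner: "bounded_bilinear (cinner :: 'h::complex_inner \<Rightarrow> 'h \<Rightarrow> complex)"
proof
  show "cinner (r *\<^sub>R a) b = r *\<^sub>R cinner a b" for r and a b :: 'h
    by (simp add: scaleR_scaleC cinner_scaleC_left scaleR_conv_of_real)
  show "cinner a (r *\<^sub>R b) = r *\<^sub>R cinner a b" for r and a b :: 'h
    by (simp add: scaleR_scaleC cinner_scaleC_right scaleR_conv_of_real)
  show "\<exists>K. \<forall>a b :: 'h. norm (cinner a b) \<le> norm a * norm b * K"
    using norm_cinner_le by (metis mult.right_neutral)
qed (simp_all add: cinner_add_left cinner_add_right)

lemmas continuous_on_cinner =
  bounded_bilinear.continuous_on[OF bounded_bilinear_cinner]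

lemma bounded_linear_scaleC: "bounded_linear (\<lambda>x :: 'h::complex_inner. c *\<^sub>C x)"
  by (rule bounded_linear_intro[where K = "cmod c"])
    (simp_all add: scaleR_scaleC scaleC_scaleC scaleC_add_right norm_scaleC mult.commute)

lemmas continuous_on_scaleC [continuous_intros] =
  bounded_linear.continuous_on[OF bounded_linear_scaleC]

lemma csubspace_imp_subspace: "csubspace S \<Longrightarrow> subspace S"
  by (simp add: complex_vector.subspace_def subspace_def scaleR_scaleC)

text \<open>Identities for operators and inner products pass from a dense subspace to the Hilbert space in
  this way, in one vector at a time.\<close>

lemma eq_from_dense:
  fixes p q :: "'b::topological_space \<Rightarrow> 'c::t2_space"
  assumes "closure S = UNIV" "continuous_on UNIV p" "continuous_on UNIV q"
    and "\<And>x. x \<in> S \<Longrightarrow> p x = q x"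
  shows "p x = q x"
proof -
  have "closed {x. p x = q x}"
    using assms by (intro closed_Collect_eq)
  then have "closure S \<subseteq> {x. p x = q x}"
    using assms by (intro closure_minimal) auto
  then show ?thesis using assms by auto
qed

text \<open>A bounded complex linear map on a dense subspace is Lipschitz, hence extends by uniform
  continuity; the algebraic identities and the bound pass to the closure.\<close>

lemma bounded_extension_from_dense:
  fixes l :: "'h::complex_hilbert_space \<Rightarrow> 'h"
  assumes S: "csubspace S" "closure S = UNIV" and lin: "clinear_on S l"
    and bound: "\<And>x. x \<in> S \<Longrightarrow> norm (l x) \<le> C * norm x"
  shows "\<exists>T \<in> bounded_ops. \<forall>x\<in>S. blinfun_apply T x = l x"
proof -
  have add: "l (x + y) = l x + l y" and scale: "l (c *\<^sub>C x) = c *\<^sub>C l x" 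
    if "x \<in> S" "y \<in> S" for x y c
    using lin that by (auto simp: clinear_on_def)
  have sub: "subspace S"
    by (rule csubspace_imp_subspace[OF S(1)])
  have diff: "l x - l y = l (x - y)" if "x \<in> S" "y \<in> S" for x y
    using add[of "x - y" y] that subspace_diff[OF sub] by simp
  have "(max C 0)-lipschitz_on S l"
  proof (rule lipschitz_onI)
    fix x y assume xy: "x \<in> S" "y \<in> S"
    have "norm (l (x - y)) \<le> C * norm (x - y)"
      using bound subspace_diff[OF sub] xy by simp
    also have "\<dots> \<le> max C 0 * norm (x - y)"
      by (intro mult_right_mono) auto
    finally show "dist (l x) (l y) \<le> max C 0 * dist x y"
      by (simp add: dist_norm diff xy)
  qed simp
  then obtain T where T: "uniformly_continuous_on (closure S) T" "\<And>x. x \<in> S \<Longrightarrow> l x = T x"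
    using uniformly_continuous_on_extension_on_closure[OF lipschitz_on_uniformly_continuous]
    by metis
  have cont: "continuous_on UNIV T"
    using T(1) S(2) uniformly_continuous_imp_continuous by metis
  have cont_comp: "continuous_on A (\<lambda>x. T (p x))" if "continuous_on A p" for p and A :: "'h set"
    by (rule continuous_on_compose2[OF cont that]) simp
  have T_scale: "T (c *\<^sub>C x) = c *\<^sub>C T x" for c x
    by (rule eq_from_dense[OF S(2)]) 
      (use scale T(2) complex_vector.subspace_scale[OF S(1)] in \<open>auto intro!: continuous_intros cont_comp cont\<close>)
  have T_add_S: "T (x + y) = T x + T y" if "x \<in> S" for x y
    by (rule eq_from_dense[OF S(2)]) 
      (use that add T(2) subspace_add[OF sub] in \<open>auto intro!: continuous_intros cont_comp cont\<close>)
  have T_add: "T (x + y) = T x + T y" for x y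
    by (rule eq_from_dense[OF S(2), of "\<lambda>x. T (x + y)" "\<lambda>x. T x + T y"])
      (use T_add_S in \<open>auto intro!: continuous_intros cont_comp cont\<close>)
  have "closed {x. norm (T x) \<le> C * norm x}"
    by (intro closed_Collect_le continuous_intros cont)
  then have "closure S \<subseteq> {x. norm (T x) \<le> C * norm x}"
    using bound T(2) by (intro closure_minimal) auto
  then have T_bound: "norm (T x) \<le> norm x * C" for x
    using S(2) by (auto simp: mult.commute)
  have "bounded_linear T"
    by (rule bounded_linear_intro[OF T_add _ T_bound]) (simp add: scaleR_scaleC T_scale)
  then have "blinfun_apply (Blinfun T) = T"
    by (rule bounded_linear_Blinfun_apply)
  then show ?thesis
    using T_add T_scale T(2) by (intro bexI[of _ "Blinfun T"]) (auto simp: bounded_ops_def clinear_on_def)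
qed

lemma blinfun_norm_le_from_dense:
  fixes T :: "'h::real_normed_vector \<Rightarrow>\<^sub>L 'b::real_normed_vector"
  assumes "closure S = UNIV" "0 \<le> C" "\<And>x. x \<in> S \<Longrightarrow> norm (T x) \<le> C * norm x"
  shows "norm T \<le> C"
proof (rule norm_blinfun_bound[OF assms(2)])
  fix x
  have "closed {x. norm (T x) \<le> C * norm x}"
    by (intro closed_Collect_le continuous_intros blinfun.continuous_on)
  then have "closure S \<subseteq> {x. norm (T x) \<le> C * norm x}"
    using assms(3) by (intro closure_minimal) auto
  then show "norm (T x) \<le> C * norm x"
    using assms(1) by auto
qed

section \<open>Etale groupoids\<close>

text \<open>The homeomorphisms in the definition of a bisection are maps of abstract topologies; the next two
  lemmas translate between these and \<^const>\<open>homeomorphism\<close>, which provides continuous inverses.\<close>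

lemma homeomorphic_map_imp_homeomorphism:
  assumes "homeomorphic_map (top_of_set S) (top_of_set (f ` S)) f"
  shows "homeomorphism S (f ` S) f (the_inv_into S f)"
proof -
  have inj: "inj_on f S"
    using homeomorphic_imp_injective_map[OF assms] by simp
  obtain g where g: "homeomorphic_maps (top_of_set S) (top_of_set (f ` S)) f g"
    using assms homeomorphic_map_maps by blast
  then have "continuous_on S f" "continuous_on (f ` S) g" "\<forall>x\<in>S. g (f x) = x"
    by (auto simp: homeomorphic_maps_def)
  moreover have "g y = the_inv_into S f y" if "y \<in> f ` S" for y
    using that calculation(3) by (auto simp: the_inv_into_f_f[OF inj])
  ultimately show ?thesis
    using continuous_on_cong[of "f ` S" "f ` S" g "the_inv_into S f"]
    by (auto simp: homeomorphism_def the_inv_into_f_f[OF inj] image_image)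
qed

lemma homeomorphism_imp_homeomorphic_map:
  "homeomorphism S T f g \<Longrightarrow> homeomorphic_map (top_of_set S) (top_of_set T) f"
  by (rule homeomorphic_maps_imp_map[where g = g])
    (auto simp: homeomorphic_maps_def homeomorphism_def)

lemma open_diff_compact_Hausdorff:
  assumes "Hausdorff_space (top_of_set V)" "compact K" "K \<subseteq> V" "open V"
  shows "open (V - K)"
proof -
  have "closedin (top_of_set V) K"
    using assms by (intro compactin_imp_closedin) (auto simp: compactin_subtopology)
  then have "openin (top_of_set V) (V - K)"
    by (simp add: openin_diff)
  then show ?thesis
    using assms(4) openin_open_trans by blast
qed

context topological_groupoid
begin

lemma rng_in_units: "rng G \<gamma> \<in> units G"
  unfolding units_def using src_rng[of \<gamma>] by (metis rangeI)

lemma unit_iff_rng: "x \<in> units G \<longleftrightarrow> rng G x = x"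
  using rng_in_units by (auto simp: units_def rng_src) (metis rangeI src_rng)

lemma unit_iff_src: "x \<in> units G \<longleftrightarrow> src G x = x"
  by (auto simp: units_def src_src) (metis rangeI)

lemma ginv_ginv [simp]: "ginv G (ginv G \<gamma>) = \<gamma>"
proof -
  have "ginv G (ginv G \<gamma>) = gmult G (ginv G (ginv G \<gamma>)) (gmult G (ginv G \<gamma>) \<gamma>)"
    by (metis mult_inv_left src_inv rng_inv src_right_unit)
  also have "\<dots> = gmult G (gmult G (ginv G (ginv G \<gamma>)) (ginv G \<gamma>)) \<gamma>"
    by (simp add: mult_assoc src_inv)
  also have "\<dots> = \<gamma>"
    by (simp add: mult_inv_left src_inv rng_left_unit)
  finally show ?thesis .
qed

lemma ginv_image_eq: "ginv G ` U = {\<gamma>. ginv G \<gamma> \<in> U}"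
  by (auto simp: image_iff) (metis ginv_ginv)

lemma open_ginv_image: "open U \<Longrightarrow> open (ginv G ` U)"
  unfolding ginv_image_eq using continuous_inv
  by (metis continuous_on_open_vimage open_UNIV Int_UNIV_right vimage_def)

lemma homeomorphism_ginv: "homeomorphism U (ginv G ` U) (ginv G) (ginv G)"
  using continuous_inv by (auto simp: homeomorphism_def image_image intro: continuous_on_subset)

lemma continuous_rng: "continuous_on S (rng G)"
proof -
  have "continuous_on S (\<lambda>\<gamma>. (\<lambda>(\<alpha>, \<beta>). gmult G \<alpha> \<beta>) (\<gamma>, ginv G \<gamma>))"
    by (rule continuous_on_compose2[OF continuous_mult])
      (auto intro!: continuous_intros continuous_on_subset[OF continuous_inv] simp: composable_def rng_inv)
  then show ?thesis by (simp add: mult_inv_right)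
qed

lemma src_eq_rng_ginv: "src G \<gamma> = rng G (ginv G \<gamma>)"
  by (simp add: rng_inv)

lemma continuous_src: "continuous_on S (src G)"
  unfolding src_eq_rng_ginv 
  by (rule continuous_on_compose2[OF continuous_rng[of UNIV]])
    (auto intro: continuous_on_subset[OF continuous_inv])

end

context etale_groupoid
begin

text \<open>If \<open>r\<close> is injective on an open set \<open>U\<close> and both \<open>\<gamma>\<close> and \<open>r \<gamma>\<close> lie in \<open>U\<close>, then \<open>\<gamma> = r \<gamma>\<close> is
  a unit.\<close>

lemma open_units: "open (units G)"
proof (subst open_subopen, intro ballI)
  fix x assume x: "x \<in> units G"
  obtain U where U: "open U" "x \<in> U" "homeo_onto_open_of_units G U (rng G)"
    using rng_local_homeomorphism by blast
  have inj: "inj_on (rng G) U"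
    using U(3) homeomorphic_imp_injective_map unfolding homeo_onto_open_of_units_def by force
  have "open (rng G -` U \<inter> U)"
    using continuous_rng[of U] U(1) continuous_on_open_vimage by blast
  moreover have "x \<in> rng G -` U \<inter> U"
    using x U(2) by (simp add: unit_iff_rng)
  moreover have "rng G -` U \<inter> U \<subseteq> units G"
    using inj by (auto simp: unit_iff_rng inj_on_def rng_rng)
  ultimately show "\<exists>T. open T \<and> x \<in> T \<and> T \<subseteq> units G"
    by blast
qed

lemma openin_units_iff: "openin (top_of_set (units G)) T \<longleftrightarrow> open T \<and> T \<subseteq> units G"
  using openin_open_eq[OF open_units] .

lemma homeo_onto_open_of_units_iff:
  "homeo_onto_open_of_units G U f \<longleftrightarrow>
     open (f ` U) \<and> f ` U \<subseteq> units G \<and> homeomorphism U (f ` U) f (the_inv_into U f)"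
  unfolding homeo_onto_open_of_units_def openin_units_iff
  using homeomorphic_map_imp_homeomorphism homeomorphism_imp_homeomorphic_map by blast

lemma homeo_onto_open_of_unitsI:
  assumes "open (f ` U)" "f ` U \<subseteq> units G" "homeomorphism U (f ` U) f g"
  shows "homeo_onto_open_of_units G U f"
  using assms homeomorphism_imp_homeomorphic_map
  unfolding homeo_onto_open_of_units_def openin_units_iff by blast

lemma homeo_onto_open_of_units_subset:
  assumes "homeo_onto_open_of_units G U f" "open U'" "U' \<subseteq> U"
  shows "homeo_onto_open_of_units G U' f"
proof -
  have h: "open (f ` U)" "f ` U \<subseteq> units G" "homeomorphism U (f ` U) f (the_inv_into U f)"
    using assms(1) by (simp_all add: homeo_onto_open_of_units_iff)
  have "openin (top_of_set U) U'"
    using assms by (auto simp: openin_open)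
  then have "openin (top_of_set (f ` U)) (f ` U')"
    using homeomorphism_imp_open_map[OF h(3)] by blast
  then have "open (f ` U')"
    using h(1) openin_open_trans by blast
  moreover have "homeomorphism U' (f ` U') f (the_inv_into U f)"
    using homeomorphism_of_subsets[OF h(3)] assms(3) by blast
  ultimately show ?thesis
    using h(2) assms(3) by (intro homeo_onto_open_of_unitsI) auto
qed

text \<open>Since \<open>s = r \<circ> inv\<close>, the source map is a local homeomorphism as well; intersecting a set that is
  good for \<open>r\<close> with one that is good for \<open>s\<close> gives a bisection.\<close>

lemma bisection_base:
  assumes "open W" "\<gamma> \<in> W"
  shows "\<exists>U. bisection G U \<and> \<gamma> \<in> U \<and> U \<subseteq> W"
proof -
  obtain U where U: "open U" "\<gamma> \<in> U" "homeo_onto_open_of_units G U (rng G)"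
    using rng_local_homeomorphism by blast
  obtain V where V: "open V" "ginv G \<gamma> \<in> V" "homeo_onto_open_of_units G V (rng G)"
    using rng_local_homeomorphism by blast
  have im: "src G ` ginv G ` V = rng G ` V"
    by (auto simp: image_image src_inv)
  have "homeomorphism (ginv G ` V) (rng G ` V) (rng G \<circ> ginv G) (ginv G \<circ> the_inv_into V (rng G))"
    using homeomorphism_compose[OF homeomorphism_symD[OF homeomorphism_ginv]] V(3)
    by (metis homeo_onto_open_of_units_iff)
  moreover have "rng G \<circ> ginv G = src G"
    by (auto simp: rng_inv)
  ultimately have "homeo_onto_open_of_units G (ginv G ` V) (src G)"
    using V(3) by (intro homeo_onto_open_of_unitsI) (auto simp: homeo_onto_open_of_units_iff im)
  moreover have "open (U \<inter> ginv G ` V \<inter> W)"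
    using U(1) open_ginv_image[OF V(1)] assms(1) by blast
  moreover have "\<gamma> \<in> U \<inter> ginv G ` V \<inter> W"
    using U(2) V(2) assms(2) by (simp add: ginv_image_eq)
  ultimately show ?thesis
    unfolding bisection_def using U(3) homeo_onto_open_of_units_subset
    by (intro exI[of _ "U \<inter> ginv G ` V \<inter> W"]) (auto intro: homeo_onto_open_of_units_subset)
qed

lemma bisection_open: "bisection G U \<Longrightarrow> open U"
  by (simp add: bisection_def)

lemma bisection_inj_rng: "bisection G U \<Longrightarrow> inj_on (rng G) U"
  unfolding bisection_def homeo_onto_open_of_units_def
  using homeomorphic_imp_injective_map by force

lemma bisection_homeomorphism_src:
  "bisection G U \<Longrightarrow> homeomorphism U (src G ` U) (src G) (the_inv_into U (src G))"
  by (simp add: bisection_def homeo_onto_open_of_units_iff)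

lemma bisection_Hausdorff:
  assumes "bisection G U"
  shows "Hausdorff_space (top_of_set U)"
proof -
  have "rng G ` U \<subseteq> units G" "homeomorphic_map (top_of_set U) (top_of_set (rng G ` U)) (rng G)"
    using assms by (auto simp: bisection_def homeo_onto_open_of_units_def rng_in_units)
  moreover have "Hausdorff_space (top_of_set (rng G ` U))"
    using Hausdorff_space_subtopology[OF units_Hausdorff, of "rng G ` U"] calculation(1)
    by (simp add: subtopology_subtopology Int_absorb1)
  ultimately show ?thesis
    using homeomorphic_Hausdorff_space homeomorphic_map_imp_homeomorphic_space by blast
qed

text \<open>An open set of units is a bisection, as \<open>r\<close> and \<open>s\<close> are the identity on units.\<close>

lemma bisection_of_units:
  assumes "open T" "T \<subseteq> units G"
  shows "bisection G T"
proof -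
  have "homeo_onto_open_of_units G T f" if "\<And>x. x \<in> T \<Longrightarrow> f x = x" for f
  proof -
    have "homeomorphism T (f ` T) f f"
      using that continuous_on_cong[of T T f "\<lambda>x. x"] by (auto simp: homeomorphism_def image_image)
    then show ?thesis
      using that assms by (intro homeo_onto_open_of_unitsI) (auto simp: image_def)
  qed
  then show ?thesis
    using assms unit_iff_src unit_iff_rng by (auto simp: bisection_def subset_iff)
qed

lemma bisection_src_image: "bisection G U \<Longrightarrow> bisection G (src G ` U)"
  by (rule bisection_of_units) (auto simp: bisection_def homeo_onto_open_of_units_iff)

text \<open>The factor \<open>2\<close> below, followed by truncation at \<open>1\<close>, turns a Urysohn function, which is only
  known to have the value \<open>1\<close> at \<open>x\<close>, into one that is constantly \<open>1\<close> near \<open>x\<close>.\<close>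

lemma units_bump:
  assumes "open T" "T \<subseteq> units G" "x \<in> T"
  obtains h :: "'a \<Rightarrow> real" and W C where "continuous_on T h" "\<And>y. y \<in> T \<Longrightarrow> h y \<in> {0..1}"
    "open W" "x \<in> W" "W \<subseteq> T" "\<And>y. y \<in> W \<Longrightarrow> h y = 1"
    "compact C" "C \<subseteq> T" "\<And>y. y \<in> T \<Longrightarrow> y \<notin> C \<Longrightarrow> h y = 0"
proof -
  let ?X = "top_of_set (units G)"
  have "neighbourhood_base_of (compactin ?X) ?X"
    using locally_compact_space_neighbourhood_base units_Hausdorff units_locally_compact by blast
  then obtain U C where UC: "openin ?X U" "compactin ?X C" "x \<in> U" "U \<subseteq> C" "C \<subseteq> T"
    unfolding neighbourhood_base_of using assms openin_units_iff by (metis (no_types))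
  have "completely_regular_space ?X"
    using locally_compact_regular_imp_completely_regular_space units_locally_compact units_Hausdorff by blast
  moreover have "closedin ?X (units G - U)" "x \<in> topspace ?X - (units G - U)"
    using UC assms by (auto simp: openin_closedin_eq)
  ultimately obtain k :: "'a \<Rightarrow> real" where k: "continuous_map ?X (top_of_set {0..1}) k" "k x = 0"
      "k ` (units G - U) \<subseteq> {1}"
    unfolding completely_regular_space_def by meson
  have kc: "continuous_on T k" and k01: "\<And>y. y \<in> T \<Longrightarrow> k y \<in> {0..1}"
    using k(1) assms(2) by (auto intro: continuous_on_subset simp: image_subset_iff)
  define h where "h y = min 1 (2 * (1 - k y))" for y
  show ?thesis
  proof (rule that[of h "k -` {..<1/2} \<inter> T" C])
    show "continuous_on T h"
      unfolding h_def by (intro continuous_intros kc)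
    show "open (k -` {..<1/2} \<inter> T)"
      using kc continuous_on_open_vimage[OF assms(1)] open_lessThan by metis
    show "h y \<in> {0..1}" if "y \<in> T" for y
      using k01[OF that] by (auto simp: h_def)
    show "h y = 0" if "y \<in> T" "y \<notin> C" for y
    proof -
      have "y \<in> units G - U"
        using that UC(4) assms(2) by blast
      then have "k y = 1"
        using k(3) by blast
      then show ?thesis by (simp add: h_def)
    qed
  qed (use UC k assms in \<open>auto simp: h_def compactin_subtopology\<close>)
qed

text \<open>The function is a bump function on the unit space composed with \<open>r\<close>. Its extension by zero
  from \<open>U\<close> to \<open>V\<close> is continuous because its support is closed in the Hausdorff space \<open>V\<close>; it
  need not be continuous on the whole, possibly non-Hausdorff, groupoid.\<close>

lemma bisection_bump:
  assumes V: "open V" "Hausdorff_space (top_of_set V)" and U: "bisection G U" "U \<subseteq> V" and \<gamma>: "\<gamma> \<in> U"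
  obtains h :: "'a \<Rightarrow> real" and W K where "continuous_on V h" "\<And>y. h y \<in> {0..1}"
    "open W" "\<gamma> \<in> W" "W \<subseteq> U" "\<And>y. y \<in> W \<Longrightarrow> h y = 1"
    "compact K" "K \<subseteq> U" "\<And>y. y \<notin> K \<Longrightarrow> h y = 0"
proof -
  define T where "T = rng G ` U"
  define i where "i = the_inv_into U (rng G)"
  have T: "open T" "T \<subseteq> units G" and hom: "homeomorphism U T (rng G) i"
    using U(1) by (simp_all add: bisection_def homeo_onto_open_of_units_iff T_def i_def)
  obtain h0 :: "'a \<Rightarrow> real" and W0 C where h0: "continuous_on T h0" "\<And>y. y \<in> T \<Longrightarrow> h0 y \<in> {0..1}"
    "open W0" "rng G \<gamma> \<in> W0" "W0 \<subseteq> T" "\<And>y. y \<in> W0 \<Longrightarrow> h0 y = 1"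
    "compact C" "C \<subseteq> T" "\<And>y. y \<in> T \<Longrightarrow> y \<notin> C \<Longrightarrow> h0 y = 0"
    using units_bump[OF T, of "rng G \<gamma>"] \<gamma> unfolding T_def by blast
  define h where "h y = (if y \<in> U then h0 (rng G y) else 0)" for y
  have oU: "open U"
    using U(1) by (rule bisection_open)
  have K: "compact (i ` C)" "i ` C \<subseteq> U"
    using hom h0(7,8) by (auto simp: homeomorphism_def intro!: compact_continuous_image intro: continuous_on_subset)
  have zero: "h y = 0" if "y \<notin> i ` C" for y
  proof (cases "y \<in> U")
    case True
    then have "rng G y \<notin> C"
      using hom that by (metis homeomorphism_apply1 image_eqI)
    then show ?thesis using True h0(9) by (auto simp: h_def T_def)
  qed (simp add: h_def)
  have "continuous_on U (\<lambda>y. h0 (rng G y))"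
    by (rule continuous_on_compose2[OF h0(1) continuous_rng]) (auto simp: T_def)
  then have "continuous_on U h"
    by (rule continuous_on_eq) (simp add: h_def)
  moreover have "continuous_on (V - i ` C) h"
    by (rule continuous_on_eq[of _ "\<lambda>_. 0"]) (auto simp: zero)
  moreover have "open (V - i ` C)"
    using open_diff_compact_Hausdorff V K U(2) by blast
  ultimately have "continuous_on (U \<union> (V - i ` C)) h"
    using oU by (intro continuous_on_open_Un)
  moreover have "U \<union> (V - i ` C) = V"
    using K U(2) by auto
  ultimately have hc: "continuous_on V h" by simp
  show ?thesis
  proof (rule that[of h "rng G -` W0 \<inter> U" "i ` C"])
    show "open (rng G -` W0 \<inter> U)"
      using continuous_rng[of U] h0(3) continuous_on_open_vimage[OF oU] by metis
    show "h y \<in> {0..1}" for y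
      using h0(2)[of "rng G y"] by (auto simp: h_def T_def)
  qed (use hc K zero \<gamma> h0 in \<open>auto simp: h_def\<close>)
qed

end

section \<open>Sections of Banach bundles\<close>

context usc_banach_bundle
begin

lemma fibre_group_simps [simp]:
  "carrier (fibre_group A x) = {a. proj A a = x}" "monoid.mult (fibre_group A x) = badd A"
  "one (fibre_group A x) = bzero A x"
  by (simp_all add: fibre_group_def)

lemma proj_bzero [simp]: "proj A (bzero A x) = x"
  using monoid.one_closed[of "fibre_group A x"] fibre_comm_group[of x]
  by (simp add: comm_group_def comm_monoid_def)

lemma proj_badd: "proj A a = proj A b \<Longrightarrow> proj A (badd A a b) = proj A a"
  using monoid.m_closed[of "fibre_group A (proj A a)" a b] fibre_comm_group[of "proj A a"]
  by (simp add: comm_group_def comm_monoid_def)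

lemma badd_bzero_left: "badd A (bzero A (proj A a)) a = a"
  using monoid.l_one[of "fibre_group A (proj A a)" a] fibre_comm_group[of "proj A a"]
  by (simp add: comm_group_def comm_monoid_def)

lemma bnorm_bzero [simp]: "bnorm A (bzero A x) = 0"
  by (simp add: norm_eq_0_iff)

text \<open>Most computations with zero elements of the bundle reduce to an estimate of the norm.\<close>

lemma eq_bzeroI: "bnorm A a \<le> 0 \<Longrightarrow> proj A a = x \<Longrightarrow> a = bzero A x"
  using norm_eq_0_iff[of a] norm_nonneg[of a] by auto

lemma bscale_0: "bscale A 0 a = bzero A (proj A a)"
  by (rule eq_bzeroI) (simp_all add: norm_scale proj_scale)

lemma bscale_bzero [simp]: "bscale A c (bzero A x) = bzero A x"
  by (rule eq_bzeroI) (simp_all add: norm_scale proj_scale)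

lemma continuous_on_bscale:
  "continuous_on S c \<Longrightarrow> continuous_on S f \<Longrightarrow> continuous_on S (\<lambda>x. bscale A (c x) (f x))"
  using continuous_on_compose2[OF scale_continuous, of S "\<lambda>x. (c x, f x)"]
  by (simp add: continuous_on_Pair)

lemma sec_subspace_is_section: "sec_subspace A {f. is_section A f}"
  by (auto simp: sec_subspace_def is_section_def sec_add_def sec_scale_def proj_badd proj_scale)

lemma sec_subspace_Cc: "sec_subspace A (Cc A)"
  unfolding Cc_def by (rule hull_in) (auto simp: sec_subspace_def)

lemma bzero_in_Cc: "bzero A \<in> Cc A"
  and sec_add_in_Cc: "f \<in> Cc A \<Longrightarrow> g \<in> Cc A \<Longrightarrow> sec_add A f g \<in> Cc A"
  and sec_scale_in_Cc: "f \<in> Cc A \<Longrightarrow> sec_scale A c f \<in> Cc A"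
  using sec_subspace_Cc by (auto simp: sec_subspace_def)

text \<open>The induction principle for \<^const>\<open>Cc\<close>, phrased with a compact set \<open>K\<close> containing the support in
  place of the support itself.\<close>

lemma Cc_subset_if_contains_sections:
  assumes S: "sec_subspace A S"
    and gen: "\<And>V K f. open V \<Longrightarrow> Hausdorff_space (top_of_set V) \<Longrightarrow> compact K \<Longrightarrow> K \<subseteq> V \<Longrightarrow>
      f \<in> sections_on A V K \<Longrightarrow> f \<in> S"
  shows "Cc A \<subseteq> S"
  unfolding Cc_def
proof (rule hull_minimal[of _ S "sec_subspace A", OF _ S], safe)
  fix f V assume f: "is_section A f" "open V" "Hausdorff_space (top_of_set V)" "continuous_on V f"
    "compact (support_in A V f)" "\<forall>\<gamma>. \<gamma> \<notin> V \<longrightarrow> f \<gamma> = bzero A \<gamma>"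
  have "{\<gamma> \<in> V. f \<gamma> \<noteq> bzero A \<gamma>} \<subseteq> support_in A V f"
    unfolding support_in_def by (rule closure_of_subset) auto
  moreover have "support_in A V f \<subseteq> V"
    unfolding support_in_def using closure_of_subset_topspace[of "top_of_set V"] by simp
  moreover have "f \<in> sections_on A V (support_in A V f)"
    using f calculation by (auto simp: sections_on_def)
  ultimately show "f \<in> S"
    using gen f by blast
qed

lemma Cc_is_section: "f \<in> Cc A \<Longrightarrow> is_section A f"
  using Cc_subset_if_contains_sections[OF sec_subspace_is_section]
  by (auto simp: sections_on_def)

lemma sections_on_subset_Cc:
  assumes V: "open V" "Hausdorff_space (top_of_set V)" and K: "compact K" "K \<subseteq> V"
    and f: "f \<in> sections_on A V K"
  shows "f \<in> Cc A"
proof -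
  have K': "compactin (top_of_set V) K"
    using K by (simp add: compactin_subtopology)
  have "{\<gamma> \<in> V. f \<gamma> \<noteq> bzero A \<gamma>} \<subseteq> K"
    using f by (auto simp: sections_on_def)
  then have "support_in A V f \<subseteq> K"
    unfolding support_in_def using compactin_imp_closedin[OF V(2) K'] by (rule closure_of_minimal)
  then have "compactin (top_of_set V) (support_in A V f)"
    using closed_compactin[OF K'] by (simp add: support_in_def)
  then have "compact (support_in A V f)"
    by (simp add: compactin_subtopology)
  then show ?thesis
    unfolding Cc_def using f V K by (intro hull_inc) (auto simp: sections_on_def)
qed

lemma sec_scale_sections_on:
  "f \<in> sections_on A U K \<Longrightarrow> sec_scale A c f \<in> sections_on A U K"
  by (auto simp: sections_on_def is_section_def sec_scale_def proj_scale intro: continuous_on_bscale)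

text \<open>An upper semicontinuous function is bounded above on a compact set: the open sets where it is
  less than \<open>n\<close> cover.\<close>

lemma sections_on_bounded:
  assumes f: "f \<in> sections_on A U K" and K: "compact K" "K \<subseteq> U"
  shows "bdd_above (range (\<lambda>\<gamma>. bnorm A (f \<gamma>)))"
proof -
  have "continuous_on K f"
    using f K(2) by (auto simp: sections_on_def intro: continuous_on_subset)
  then have "compact (f ` K)"
    using K(1) by (rule compact_continuous_image)
  moreover have "f ` K \<subseteq> (\<Union>n\<in>UNIV. {a. bnorm A a < real n})"
    using reals_Archimedean2 by auto
  ultimately obtain C where C: "finite C" "f ` K \<subseteq> (\<Union>n\<in>C. {a. bnorm A a < real n})"
    using compactE_image[of "f ` K" UNIV "\<lambda>n. {a. bnorm A a < real n}"]
      norm_upper_semicontinuous by metis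
  have "bnorm A (f \<gamma>) \<le> (\<Sum>n\<in>C. real n)" for \<gamma>
  proof (cases "\<gamma> \<in> K")
    case True
    then obtain n where "n \<in> C" "bnorm A (f \<gamma>) < real n"
      using C(2) by auto
    then show ?thesis
      using member_le_sum[of n C real] C(1) by simp
  next
    case False
    then show ?thesis using f by (simp add: sections_on_def sum_nonneg)
  qed
  then show ?thesis by (rule bdd_aboveI2)
qed

lemma bnorm_le_sup_norm:
  assumes "f \<in> sections_on A U K" "compact K" "K \<subseteq> U"
  shows "bnorm A (f \<gamma>) \<le> sup_norm A f"
  unfolding sup_norm_def by (rule cSUP_upper[OF _ sections_on_bounded[OF assms]]) simp

lemma sup_norm_le: "(\<And>\<gamma>. bnorm A (f \<gamma>) \<le> s) \<Longrightarrow> sup_norm A f \<le> s"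
  unfolding sup_norm_def by (rule cSUP_least) auto

end

locale etale_fell_bundle = etale_groupoid G + fell_bundle G A
  for G :: "'g::topological_space groupoid_data"
    and A :: "('g, 'a::topological_space, 'm) fell_bundle_data_scheme"
begin

lemma bisection_sections_on_in_Cc:
  "bisection G U \<Longrightarrow> compact K \<Longrightarrow> K \<subseteq> U \<Longrightarrow> f \<in> sections_on A U K \<Longrightarrow> f \<in> Cc A"
  by (rule sections_on_subset_Cc[OF bisection_open bisection_Hausdorff])

text \<open>Sections supported in bisections span \<^const>\<open>Cc\<close>. The support \<open>K\<close> of a section \<open>f\<close> over the
  open Hausdorff set \<open>V\<close> is covered by finitely many open sets \<open>W\<close>, each with a function \<open>h\<close> that is
  \<open>1\<close> on \<open>W\<close> and is compactly supported in a bisection. In place of a partition of unity, one such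
  set is removed at a time: \<open>f = h f + (1 - h) f\<close>, where \<open>h f\<close> is supported in a bisection and
  \<open>(1 - h) f\<close> vanishes outside \<open>K - W\<close>, which is covered by the remaining sets.\<close>

lemma Cc_subset_if_contains_bisection_sections:
  assumes S: "sec_subspace A S"
    and gen: "\<And>U K f. bisection G U \<Longrightarrow> compact K \<Longrightarrow> K \<subseteq> U \<Longrightarrow> f \<in> sections_on A U K \<Longrightarrow> f \<in> S"
  shows "Cc A \<subseteq> S"
proof (rule Cc_subset_if_contains_sections[OF S])
  fix V K f
  assume V: "open V" "Hausdorff_space (top_of_set V)"
    and K: "compact K" "K \<subseteq> V" and f: "f \<in> sections_on A V K"
  define good where "good W \<longleftrightarrow> open W \<and> (\<exists>h U K'. continuous_on V h \<and> bisection G U \<and> U \<subseteq> V \<and>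
    compact K' \<and> K' \<subseteq> U \<and> (\<forall>\<gamma>\<in>W. h \<gamma> = (1::real)) \<and> (\<forall>\<gamma>. \<gamma> \<notin> K' \<longrightarrow> h \<gamma> = 0))" for W
  have "\<exists>W. good W \<and> \<gamma> \<in> W" if "\<gamma> \<in> K" for \<gamma>
  proof -
    obtain U where U: "bisection G U" "\<gamma> \<in> U" "U \<subseteq> V"
      using bisection_base V(1) K(2) \<open>\<gamma> \<in> K\<close> by (meson subsetD)
    then obtain h W K' where "continuous_on V h" "open W" "\<gamma> \<in> W" "\<And>y. y \<in> W \<Longrightarrow> h y = (1::real)"
      "compact K'" "K' \<subseteq> U" "\<And>y. y \<notin> K' \<Longrightarrow> h y = 0"
      using bisection_bump[OF V U(1,3,2)] by metis
    then show ?thesis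
      unfolding good_def using U by blast
  qed
  then have "K \<subseteq> \<Union>{W. good W}" by auto
  then obtain \<W> where \<W>: "\<W> \<subseteq> {W. good W}" "finite \<W>" "K \<subseteq> \<Union>\<W>"
  proof (rule compactE[OF K(1)])
    show "open W" if "W \<in> {W. good W}" for W
      using that by (simp add: good_def)
  qed
  from \<W>(2,1,3) K f show "f \<in> S"
  proof (induction \<W> arbitrary: K f)
    case empty
    then have "f = bzero A" by (auto simp: sections_on_def)
    then show ?case using S by (simp add: sec_subspace_def)
  next
    case (insert W \<W>)
    obtain h U K' where h: "continuous_on V h" "bisection G U" "U \<subseteq> V" "compact K'" "K' \<subseteq> U"
      "\<And>\<gamma>. \<gamma> \<in> W \<Longrightarrow> h \<gamma> = (1::real)" "\<And>\<gamma>. \<gamma> \<notin> K' \<Longrightarrow> h \<gamma> = 0" and W: "open W"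
      using insert.prems(1) unfolding good_def by auto
    define f\<^sub>1 where "f\<^sub>1 \<gamma> = bscale A (of_real (h \<gamma>)) (f \<gamma>)" for \<gamma>
    define f\<^sub>2 where "f\<^sub>2 \<gamma> = bscale A (of_real (1 - h \<gamma>)) (f \<gamma>)" for \<gamma>
    have f: "is_section A f" "continuous_on V f" "\<And>\<gamma>. \<gamma> \<notin> K \<Longrightarrow> f \<gamma> = bzero A \<gamma>"
      using insert.prems by (auto simp: sections_on_def)
    have proj_f: "proj A (f \<gamma>) = \<gamma>" for \<gamma>
      using f(1) by (simp add: is_section_def)
    have "continuous_on V f\<^sub>1"
      unfolding f\<^sub>1_def by (intro continuous_on_bscale continuous_intros h(1) f(2))
    then have "f\<^sub>1 \<in> sections_on A U K'"
      using h(3) by (auto simp: sections_on_def is_section_def f\<^sub>1_def proj_scale proj_f h(7) bscale_0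
          intro: continuous_on_subset)
    then have "f\<^sub>1 \<in> S"
      using gen h by blast
    moreover have "f\<^sub>2 \<in> S"
    proof (rule insert.IH)
      have "continuous_on V f\<^sub>2"
        unfolding f\<^sub>2_def by (intro continuous_on_bscale continuous_intros h(1) f(2))
      then show "f\<^sub>2 \<in> sections_on A V (K - W)"
        using h(6) f(3) by (auto simp: sections_on_def is_section_def f\<^sub>2_def proj_scale proj_f bscale_0)
      show "compact (K - W)"
        using insert.prems W by (intro compact_diff)
    qed (use insert.prems in auto)
    moreover have "sec_add A f\<^sub>1 f\<^sub>2 = f"
      by (simp add: sec_add_def f\<^sub>1_def f\<^sub>2_def scale_one flip: scale_add_left)
    ultimately show ?case
      using S by (metis sec_subspace_def)
  qed
qed

section \<open>Involution and convolution on bisections\<close>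

lemma bnorm_fmult_fstar_self_le:
  "bnorm A a \<le> s \<Longrightarrow> bnorm A (fmult A (fstar A a) a) \<le> s\<^sup>2"
  by (simp add: norm_fstar_fmult norm_nonneg power_mono)

lemma fmult_bzero_left:
  "(\<alpha>, proj A b) \<in> composable G \<Longrightarrow> fmult A (bzero A \<alpha>) b = bzero A (gmult G \<alpha> (proj A b))"
  using norm_fmult[of "bzero A \<alpha>" b] proj_fmult[of "bzero A \<alpha>" b] by (intro eq_bzeroI) auto

lemma fmult_bzero_right:
  "(proj A a, \<beta>) \<in> composable G \<Longrightarrow> fmult A a (bzero A \<beta>) = bzero A (gmult G (proj A a) \<beta>)"
  using norm_fmult[of a "bzero A \<beta>"] proj_fmult[of a "bzero A \<beta>"] by (intro eq_bzeroI) auto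

lemma fstar_bzero: "fstar A (bzero A x) = bzero A (ginv G x)"
  using fstar_scale[of 0 "bzero A x"] by (simp add: bscale_0 proj_fstar)

lemma sec_star_sections_on:
  assumes "f \<in> sections_on A U K"
  shows "sec_star G A f \<in> sections_on A (ginv G ` U) (ginv G ` K)"
proof -
  have f: "\<And>\<gamma>. proj A (f \<gamma>) = \<gamma>" "continuous_on U f" "\<And>\<gamma>. \<gamma> \<notin> K \<Longrightarrow> f \<gamma> = bzero A \<gamma>"
    using assms by (auto simp: sections_on_def is_section_def)
  have "continuous_on (ginv G ` U) (\<lambda>\<gamma>. f (ginv G \<gamma>))"
    by (rule continuous_on_compose2[OF f(2) continuous_on_subset[OF continuous_inv]]) auto
  then have "continuous_on (ginv G ` U) (sec_star G A f)"
    unfolding sec_star_def by (rule continuous_on_compose2[OF fstar_continuous]) auto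
  moreover have "sec_star G A f \<gamma> = bzero A \<gamma>" if "\<gamma> \<notin> ginv G ` K" for \<gamma>
    using that f(3) by (simp add: sec_star_def ginv_image_eq fstar_bzero)
  ultimately show ?thesis
    by (simp add: sections_on_def is_section_def sec_star_def proj_fstar f(1))
qed

lemma sec_star_in_Cc:
  assumes "f \<in> Cc A"
  shows "sec_star G A f \<in> Cc A"
proof -
  have "Cc A \<subseteq> {f \<in> Cc A. sec_star G A f \<in> Cc A}"
  proof (rule Cc_subset_if_contains_sections)
    have "sec_star G A (bzero A) = bzero A"
      by (simp add: sec_star_def fstar_bzero)
    moreover have "sec_star G A (sec_add A f g) = sec_add A (sec_star G A f) (sec_star G A g)"
      if "f \<in> Cc A" "g \<in> Cc A" for f g
      using that[THEN Cc_is_section] by (simp add: sec_star_def sec_add_def fstar_add is_section_def)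
    moreover have "sec_star G A (sec_scale A c f) = sec_scale A (cnj c) (sec_star G A f)" for f c
      by (simp add: sec_star_def sec_scale_def fstar_scale)
    ultimately show "sec_subspace A {f \<in> Cc A. sec_star G A f \<in> Cc A}"
      by (auto simp: sec_subspace_def bzero_in_Cc sec_add_in_Cc sec_scale_in_Cc)
  next
    fix V K f assume V: "open V" "Hausdorff_space (top_of_set V)"
      and K: "compact K" "K \<subseteq> V" and f: "f \<in> sections_on A V K"
    have "Hausdorff_space (top_of_set (ginv G ` V))"
      using homeomorphism_imp_homeomorphic_map[OF homeomorphism_ginv[of V]] V(2)
        homeomorphic_Hausdorff_space homeomorphic_map_imp_homeomorphic_space by blast
    moreover have "compact (ginv G ` K)"
      by (rule compact_continuous_image[OF continuous_on_subset[OF continuous_inv] K(1)]) simp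
    ultimately have "sec_star G A f \<in> Cc A"
      using K(2) by (intro sections_on_subset_Cc[OF _ _ _ _ sec_star_sections_on[OF f]] 
          open_ginv_image V(1)) auto
    then show "f \<in> {f \<in> Cc A. sec_star G A f \<in> Cc A}"
      using sections_on_subset_Cc[OF V K f] by simp
  qed
  then show ?thesis using assms by blast
qed

text \<open>If \<open>f(\<alpha>\<^bsup>-1\<^esup>)\<^sup>* f(\<beta>)\<close> does not vanish, then \<open>\<alpha>\<^bsup>-1\<^esup>\<close> and \<open>\<beta>\<close> are elements of the bisection \<open>U\<close>
  with the same range, hence are equal. So \<open>f\<^sup>* * f\<close> lives on \<open>s(U)\<close>, where the convolution sum has
  at most one term, \<open>(f\<^sup>* * f)(s(\<beta>)) = f(\<beta>)\<^sup>* f(\<beta>)\<close>.\<close>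

lemma conv_star_self_factor:
  assumes U: "bisection G U" and f: "is_section A f" "\<And>\<gamma>. \<gamma> \<notin> U \<Longrightarrow> f \<gamma> = bzero A \<gamma>"
    and \<alpha>\<beta>: "(\<alpha>, \<beta>) \<in> composable G" "fmult A (sec_star G A f \<alpha>) (f \<beta>) \<noteq> bzero A (gmult G \<alpha> \<beta>)"
  shows "\<beta> \<in> U \<and> \<alpha> = ginv G \<beta>"
proof -
  have proj_f: "proj A (f \<gamma>) = \<gamma>" for \<gamma>
    using f(1) by (simp add: is_section_def)
  have "ginv G \<alpha> \<in> U"
  proof (rule ccontr)
    assume "ginv G \<alpha> \<notin> U"
    then have "sec_star G A f \<alpha> = bzero A \<alpha>"
      by (simp add: sec_star_def f(2) fstar_bzero)
    then show False
      using \<alpha>\<beta> fmult_bzero_left[of \<alpha> "f \<beta>"] by (simp add: proj_f)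
  qed
  moreover have "\<beta> \<in> U"
  proof (rule ccontr)
    assume "\<beta> \<notin> U"
    moreover have "proj A (sec_star G A f \<alpha>) = \<alpha>"
      by (simp add: sec_star_def proj_fstar proj_f)
    ultimately show False
      using \<alpha>\<beta> fmult_bzero_right[of "sec_star G A f \<alpha>" \<beta>] by (simp add: f(2))
  qed
  moreover have "rng G (ginv G \<alpha>) = rng G \<beta>"
    using \<alpha>\<beta>(1) by (simp add: composable_def rng_inv)
  ultimately have "ginv G \<alpha> = \<beta>"
    using bisection_inj_rng[OF U] by (auto dest: inj_onD)
  then show ?thesis
    using \<open>\<beta> \<in> U\<close> by auto
qed

lemma conv_star_self_src:
  assumes U: "bisection G U" and f: "is_section A f" "\<And>\<gamma>. \<gamma> \<notin> U \<Longrightarrow> f \<gamma> = bzero A \<gamma>"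
    and \<beta>: "\<beta> \<in> U"
  shows "conv G A (sec_star G A f) f (src G \<beta>) = fmult A (fstar A (f \<beta>)) (f \<beta>)"
proof -
  let ?F = "fibre_group A (src G \<beta>)" and ?t = "\<lambda>(\<alpha>, \<beta>). fmult A (sec_star G A f \<alpha>) (f \<beta>)"
  let ?I = "{(\<alpha>, \<beta>') \<in> composable G. gmult G \<alpha> \<beta>' = src G \<beta> \<and> fmult A (sec_star G A f \<alpha>) (f \<beta>') \<noteq> bzero A (src G \<beta>)}"
  let ?p = "(ginv G \<beta>, \<beta>)"
  interpret F: comm_group ?F
    by (rule fibre_comm_group)
  have t: "?t ?p = fmult A (fstar A (f \<beta>)) (f \<beta>)"
    by (simp add: sec_star_def)
  have comp: "?p \<in> composable G"
    by (simp add: composable_def src_inv)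
  have inj: "inj_on (src G) U"
    using bisection_homeomorphism_src[OF U] by (auto simp: homeomorphism_def intro: inj_on_inverseI)
  have sub: "?I \<subseteq> {?p}"
  proof clarify
    fix \<alpha> \<beta>'
    assume *: "(\<alpha>, \<beta>') \<in> composable G" "gmult G \<alpha> \<beta>' = src G \<beta>"
      "fmult A (sec_star G A f \<alpha>) (f \<beta>') \<noteq> bzero A (src G \<beta>)"
    then have "\<beta>' \<in> U" "\<alpha> = ginv G \<beta>'"
      using conv_star_self_factor[OF U f] by metis+
    moreover from this have "src G \<beta>' = src G \<beta>"
      using *(2) by (simp add: mult_inv_left)
    ultimately show "\<alpha> = ginv G \<beta> \<and> \<beta>' = \<beta>"
      using inj \<beta> by (auto dest: inj_onD)
  qed
  have proj_t: "proj A (fmult A (fstar A (f \<beta>)) (f \<beta>)) = src G \<beta>"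
    using f(1) by (simp add: proj_fmult proj_fstar is_section_def composable_def src_inv mult_inv_left)
  show ?thesis
  proof (cases "fmult A (fstar A (f \<beta>)) (f \<beta>) = bzero A (src G \<beta>)")
    case True
    then have "?p \<notin> ?I" using t by simp
    then have "?I = {}" using sub by blast
    then show ?thesis
      unfolding conv_def by (simp only: F.finprod_empty) (simp add: True)
  next
    case False
    then have "?p \<in> ?I" using t comp by (simp add: mult_inv_left)
    then have "?I = {?p}" using sub by blast
    then have "conv G A (sec_star G A f) f (src G \<beta>) = finprod ?F ?t {?p}"
      unfolding conv_def by simp
    also have "\<dots> = ?t ?p"
      using F.finprod_insert[of "{}" ?p ?t] F.r_one[of "?t ?p"] t proj_t by simp
    finally show ?thesis by (simp only: t)
  qed
qed

lemma conv_star_self_outside: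
  assumes U: "bisection G U" and f: "is_section A f" "\<And>\<gamma>. \<gamma> \<notin> U \<Longrightarrow> f \<gamma> = bzero A \<gamma>"
    and \<gamma>: "\<gamma> \<notin> src G ` U"
  shows "conv G A (sec_star G A f) f \<gamma> = bzero A \<gamma>"
proof -
  interpret F: comm_group "fibre_group A \<gamma>"
    by (rule fibre_comm_group)
  have "{(\<alpha>, \<beta>) \<in> composable G. gmult G \<alpha> \<beta> = \<gamma> \<and> fmult A (sec_star G A f \<alpha>) (f \<beta>) \<noteq> bzero A \<gamma>} = {}"
  proof -
    have False if "(\<alpha>, \<beta>) \<in> composable G" "gmult G \<alpha> \<beta> = \<gamma>"
      "fmult A (sec_star G A f \<alpha>) (f \<beta>) \<noteq> bzero A \<gamma>" for \<alpha> \<beta>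
    proof -
      have "\<beta> \<in> U \<and> \<alpha> = ginv G \<beta>"
        by (rule conv_star_self_factor[OF U f]) (use that in auto)
      then show False
        using that(2) \<gamma> by (auto simp: mult_inv_left)
    qed
    then show ?thesis by auto
  qed
  then show ?thesis
    unfolding conv_def by (simp only: F.finprod_empty) simp
qed

text \<open>Over \<open>s(U)\<close> the section \<open>f\<^sup>* * f\<close> is composed of continuous maps, the first of which is the
  inverse of the homeomorphism \<open>s : U \<rightarrow> s(U)\<close>. The bound is the \<open>C\<^sup>*\<close>-identity in the fibres.\<close>

lemma conv_star_self_sections_on:
  assumes U: "bisection G U" and K: "K \<subseteq> U" and f: "f \<in> sections_on A U K"
  shows "conv G A (sec_star G A f) f \<in> sections_on A (src G ` U) (src G ` K)"
    and "(\<And>\<gamma>. bnorm A (f \<gamma>) \<le> s) \<Longrightarrow> bnorm A (conv G A (sec_star G A f) f \<gamma>) \<le> s\<^sup>2"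
proof -
  let ?g = "conv G A (sec_star G A f) f"
  have zero: "f \<gamma> = bzero A \<gamma>" if "\<gamma> \<notin> K" for \<gamma>
    using f that by (auto simp: sections_on_def)
  have sec: "is_section A f"
    using f by (auto simp: sections_on_def)
  have proj_f: "proj A (f \<gamma>) = \<gamma>" for \<gamma>
    using sec by (simp add: is_section_def)
  note on = conv_star_self_src[OF U sec] and off = conv_star_self_outside[OF U sec]
  have zeroU: "f \<gamma> = bzero A \<gamma>" if "\<gamma> \<notin> U" for \<gamma>
    using zero that K by blast
  have proj_on: "proj A (fmult A (fstar A (f \<beta>)) (f \<beta>)) = src G \<beta>" for \<beta>
    by (simp add: proj_fmult proj_fstar proj_f composable_def src_inv mult_inv_left)
  have g_sec: "is_section A ?g"
    unfolding is_section_def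
  proof
    fix \<gamma> show "proj A (?g \<gamma>) = \<gamma>"
      using on[OF zeroU] off[OF zeroU] proj_on by (cases "\<gamma> \<in> src G ` U") auto
  qed
  have g_zero: "?g \<gamma> = bzero A \<gamma>" if "\<gamma> \<notin> src G ` K" for \<gamma>
  proof (cases "\<gamma> \<in> src G ` U")
    case True
    then obtain \<beta> where \<beta>: "\<gamma> = src G \<beta>" "\<beta> \<in> U" by blast
    then have "f \<beta> = bzero A \<beta>" using that zero by blast
    then show ?thesis
      using on[OF zeroU \<beta>(2)] \<beta>(1) fmult_bzero_right[of "fstar A (f \<beta>)" \<beta>]
      by (simp add: proj_fstar composable_def src_inv mult_inv_left)
  qed (use off zeroU in blast)
  define \<sigma> where "\<sigma> = the_inv_into U (src G)"
  have hom: "homeomorphism U (src G ` U) (src G) \<sigma>"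
    unfolding \<sigma>_def by (rule bisection_homeomorphism_src[OF U])
  have "continuous_on (src G ` U) (\<lambda>x. f (\<sigma> x))"
  proof (rule continuous_on_compose2[of U f])
    show "continuous_on U f"
      using f by (simp add: sections_on_def)
    show "continuous_on (src G ` U) \<sigma>" "\<sigma> ` src G ` U \<subseteq> U"
      using hom by (simp_all add: homeomorphism_def)
  qed
  then have "continuous_on (src G ` U) (\<lambda>x. (fstar A (f (\<sigma> x)), f (\<sigma> x)))"
    by (intro continuous_on_Pair continuous_on_compose2[OF fstar_continuous]) auto
  then have "continuous_on (src G ` U) (\<lambda>x. (\<lambda>(a, b). fmult A a b) (fstar A (f (\<sigma> x)), f (\<sigma> x)))"
    by (rule continuous_on_compose2[OF fmult_continuous])
      (auto simp: proj_fstar proj_f composable_def src_inv)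
  then have "continuous_on (src G ` U) ?g"
  proof (rule continuous_on_eq)
    fix x assume x: "x \<in> src G ` U"
    then have "\<sigma> x \<in> U" "src G (\<sigma> x) = x"
      using hom by (auto simp: homeomorphism_def)
    then show "(\<lambda>(a, b). fmult A a b) (fstar A (f (\<sigma> x)), f (\<sigma> x)) = ?g x"
      using on[OF zeroU, of "\<sigma> x"] by simp
  qed
  then show "?g \<in> sections_on A (src G ` U) (src G ` K)"
    using g_sec g_zero by (simp add: sections_on_def)
  show "bnorm A (?g \<gamma>) \<le> s\<^sup>2" if "\<And>\<gamma>. bnorm A (f \<gamma>) \<le> s"
    using on[OF zeroU] off[OF zeroU] bnorm_fmult_fstar_self_le[OF that]
    by (cases "\<gamma> \<in> src G ` U") auto
qed

end

section \<open>Continuous functionals for the inductive limit topology\<close>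

context etale_fell_bundle
begin

lemma zero_nhd_Cc: "zero_nhd G A (Cc A)"
  unfolding zero_nhd_def
proof (intro conjI allI impI ballI)
  show "\<exists>t::real. t > 0 \<and> sec_scale A (of_real t) f \<in> Cc A" if "f \<in> Cc A" for f
    using that by (intro exI[of _ 1] conjI sec_scale_in_Cc) simp_all
  show "\<exists>e>0. \<forall>f\<in>sections_on A U K. sup_norm A f < e \<longrightarrow> f \<in> Cc A"
    if "bisection G U \<and> compact K \<and> K \<subseteq> U" for U K
    using that bisection_sections_on_in_Cc by (intro exI[of _ 1]) auto
qed (auto intro: sec_add_in_Cc sec_scale_in_Cc)

lemma topspace_ind_limit_topology [simp]: "topspace (ind_limit_topology G A) = Cc A"
proof (rule antisym)
  show "topspace (ind_limit_topology G A) \<subseteq> Cc A"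
    using openin_topspace[of "ind_limit_topology G A"] openin_ind_limit_topology by blast
  have "openin (ind_limit_topology G A) (Cc A)"
    unfolding openin_ind_limit_topology using zero_nhd_Cc sec_add_in_Cc by blast
  then show "Cc A \<subseteq> topspace (ind_limit_topology G A)"
    by (rule openin_subset)
qed

lemma sec_add_bzero_left: "is_section A f \<Longrightarrow> sec_add A (bzero A) f = f"
  by (rule ext) (metis sec_add_def is_section_def badd_bzero_left)

text \<open>Some neighbourhood \<open>N\<close> of zero is mapped into the unit disc, and \<open>N\<close> contains the sections of
  norm less than \<open>e\<close> that vanish outside \<open>K\<close>; scaling a section of norm at most \<open>s\<close> by \<open>e/(2s)\<close>
  brings it into \<open>N\<close>. The bound is stated for positive upper bounds \<open>s\<close> of the norm so that
  \<open>s\<close> may be divided by.\<close>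

lemma continuous_functional_bounded_on_sections:
  assumes cont: "continuous_map (ind_limit_topology G A) euclidean \<phi>"
    and scale: "\<And>c f. f \<in> Cc A \<Longrightarrow> \<phi> (sec_scale A c f) = c * \<phi> f"
    and U: "bisection G U" and K: "compact K" "K \<subseteq> U"
  shows "\<exists>C. \<forall>f\<in>sections_on A U K. \<forall>s>0. (\<forall>\<gamma>. bnorm A (f \<gamma>) \<le> s) \<longrightarrow> cmod (\<phi> f) \<le> C * s"
proof -
  let ?W = "{f \<in> topspace (ind_limit_topology G A). \<phi> f \<in> ball 0 1}"
  have "openin (ind_limit_topology G A) ?W"
    by (rule openin_continuous_map_preimage[OF cont]) simp
  moreover have "\<phi> (bzero A) = 0"
    using scale[OF bzero_in_Cc, of 0] by (simp add: sec_scale_def)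
  then have "bzero A \<in> ?W"
    by (simp add: bzero_in_Cc)
  ultimately obtain N where N: "zero_nhd G A N" "\<forall>g\<in>N. sec_add A (bzero A) g \<in> ?W"
    unfolding openin_ind_limit_topology by blast
  then obtain e where e: "e > 0" "\<forall>f\<in>sections_on A U K. sup_norm A f < e \<longrightarrow> f \<in> N"
    using zero_nhd_trace[OF N(1)] U K by blast
  show ?thesis
  proof (intro exI[of _ "2 / e"] ballI allI impI)
    fix f and s :: real assume f: "f \<in> sections_on A U K" and s: "s > 0" "\<forall>\<gamma>. bnorm A (f \<gamma>) \<le> s"
    define t where "t = e / (2 * s)"
    have t: "t > 0" "t * s = e / 2"
      using e s by (simp_all add: t_def)
    let ?g = "sec_scale A (of_real t) f"
    have g: "?g \<in> sections_on A U K"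
      by (rule sec_scale_sections_on[OF f])
    have "bnorm A (?g \<gamma>) \<le> e / 2" for \<gamma>
      using mult_left_mono[OF s(2)[rule_format], of t \<gamma>] t by (simp add: sec_scale_def norm_scale)
    then have "sup_norm A ?g \<le> e / 2"
      by (rule sup_norm_le)
    then have "?g \<in> N"
      using e g by auto
    moreover have "sec_add A (bzero A) ?g = ?g"
      using g by (intro sec_add_bzero_left) (simp add: sections_on_def)
    ultimately have "cmod (\<phi> ?g) < 1"
      using N(2) by force
    then have "t * cmod (\<phi> f) < 1"
      using scale[OF bisection_sections_on_in_Cc[OF U K f]] t by (simp add: norm_mult)
    then have "cmod (\<phi> f) < 1 / t"
      using t by (simp add: field_simps)
    also have "1 / t = 2 / e * s"
      using e s by (simp add: t_def)
    finally show "cmod (\<phi> f) \<le> 2 / e * s"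
      by simp
  qed
qed

text \<open>As \<open>f\<^sup>* * f\<close> is self-adjoint, the \<open>n\<close>-th iterate is \<open>(f\<^sup>* * f)\<close> to the power \<open>2\<^bsup>n-1\<^esup>\<close> for \<open>n > 0\<close>.
  The recursion makes the properties of these powers immediate from those of \<open>f\<^sup>* * f\<close>.\<close>

primrec star_square :: "('g \<Rightarrow> 'a) \<Rightarrow> nat \<Rightarrow> 'g \<Rightarrow> 'a" where
  "star_square f 0 = f"
| "star_square f (Suc n) = conv G A (sec_star G A (star_square f n)) (star_square f n)"

text \<open>All the iterates except \<open>f\<close> itself live over the same compact subset \<open>s(K)\<close> of the unit
  space, because \<open>s\<close> is the identity on units. Thus a single constant from
  \<open>continuous_functional_bounded_on_sections\<close> serves for all of them.\<close>

lemma star_square_sections_on: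
  assumes U: "bisection G U" and K: "K \<subseteq> U" and f: "f \<in> sections_on A U K"
  shows "star_square f (Suc n) \<in> sections_on A (src G ` U) (src G ` K)"
proof (induction n)
  case 0
  show ?case using conv_star_self_sections_on(1)[OF U K f] by simp
next
  case (Suc n)
  show ?case
    using conv_star_self_sections_on(1)[OF bisection_src_image[OF U] _ Suc] K
    by (simp add: image_image src_src image_mono)
qed

lemma bnorm_star_square_le:
  assumes U: "bisection G U" and K: "K \<subseteq> U" and f: "f \<in> sections_on A U K"
    and s: "\<And>\<gamma>. bnorm A (f \<gamma>) \<le> s"
  shows "bnorm A (star_square f n \<gamma>) \<le> s ^ (2 ^ n)"
proof -
  have "\<exists>V K'. bisection G V \<and> K' \<subseteq> V \<and> star_square f n \<in> sections_on A V K'" for n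
  proof (cases n)
    case (Suc m)
    then show ?thesis
      using star_square_sections_on[OF U K f] bisection_src_image[OF U] image_mono[OF K] by metis
  qed (use U K f in auto)
  then have step: "bnorm A (star_square f (Suc n) \<gamma>) \<le> c\<^sup>2"
    if "\<And>\<gamma>. bnorm A (star_square f n \<gamma>) \<le> c" for n c \<gamma>
    using conv_star_self_sections_on(2) that by simp metis
  show ?thesis
  proof (induction n arbitrary: \<gamma>)
    case (Suc n)
    have "bnorm A (star_square f (Suc n) \<gamma>) \<le> (s ^ (2 ^ n))\<^sup>2"
      by (rule step[OF Suc])
    then show ?case by (simp add: power2_eq_square mult_2 flip: power_add)
  qed (simp add: s)
qed

end

section \<open>Boundedness of pre-representations\<close>

text \<open>The numbers \<open>y n = x n / (N s\<^bsup>2^n\<^esup>)\<close> are bounded and satisfy \<open>(y n)\<^sup>2 \<le> y (n + 1)\<close>. If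
  \<open>y 0 > 1\<close>, then \<open>y n\<close> would be at least \<open>(y 0)\<^bsup>n+1\<^esup>\<close> and so would be unbounded.\<close>

lemma bound_from_quadratic_recursion:
  fixes x :: "nat \<Rightarrow> real"
  assumes N: "N \<ge> 0" and s: "s > 0"
    and step: "\<And>n. (x n)\<^sup>2 \<le> N * x (Suc n)" and growth: "\<And>n. (x n)\<^sup>2 \<le> C * s ^ 2 ^ Suc n"
  shows "x 0 \<le> N * s"
proof (rule ccontr)
  assume "\<not> x 0 \<le> N * s"
  then have x0: "x 0 > N * s" by simp
  have "N \<noteq> 0"
    using step[of 0] x0 by auto
  then have N: "N > 0" using N by simp
  define y where "y n = x n / (N * s ^ 2 ^ n)" for n
  have sq: "(y n)\<^sup>2 = (x n)\<^sup>2 / (N\<^sup>2 * s ^ 2 ^ Suc n)" for n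
    by (simp add: y_def power_divide power_mult_distrib power2_eq_square mult_2 flip: power_add)
  have y0: "y 0 > 1"
    using x0 N s by (simp add: y_def field_simps)
  have "(y n)\<^sup>2 \<le> (N * x (Suc n)) / (N\<^sup>2 * s ^ 2 ^ Suc n)" for n
    unfolding sq using step N s by (intro divide_right_mono) auto
  then have y_step: "(y n)\<^sup>2 \<le> y (Suc n)" for n
    using N by (simp add: y_def power2_eq_square)
  have "(y n)\<^sup>2 \<le> (C * s ^ 2 ^ Suc n) / (N\<^sup>2 * s ^ 2 ^ Suc n)" for n
    unfolding sq using growth N s by (intro divide_right_mono) auto
  then have y_bound: "(y n)\<^sup>2 \<le> C / N\<^sup>2" for n
    using s by simp
  have y_ge: "y 0 ^ Suc n \<le> y n" for n
  proof (induction n)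
    case (Suc n)
    have "y 0 ^ Suc (Suc n) \<le> (y 0 ^ Suc n)\<^sup>2"
      using y0 by (subst power_mult[symmetric]) (intro power_increasing, simp_all)
    also have "\<dots> \<le> (y n)\<^sup>2"
      using Suc y0 by (intro power_mono) auto
    also have "\<dots> \<le> y (Suc n)"
      by (rule y_step)
    finally show ?case .
  qed simp
  obtain n where n: "C / N\<^sup>2 < y 0 ^ n"
    using real_arch_pow[OF y0] by blast
  have "y 0 ^ n \<le> y 0 ^ Suc n"
    using y0 by simp
  also have "y 0 ^ Suc n \<le> y n" by (rule y_ge)
  also have "y n \<le> y n * y n"
  proof -
    have "1 \<le> y 0 ^ Suc n" using y0 by (intro one_le_power) simp
    then have "1 \<le> y n" using y_ge[of n] by linarith
    then show ?thesis by simp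
  qed
  also have "\<dots> \<le> C / N\<^sup>2"
    using y_bound[of n] by (simp add: power2_eq_square)
  finally show False using n by simp
qed

locale etale_pre_representation = etale_fell_bundle G A + pre_representation G A H0 L
  for G :: "'g::topological_space groupoid_data"
    and A :: "('g, 'a::topological_space, 'm) fell_bundle_data_scheme"
    and H0 :: "'h::complex_hilbert_space set"
    and L :: "('g \<Rightarrow> 'a) \<Rightarrow> 'h \<Rightarrow> 'h"
begin

lemma H00_subset_H0: "H00 A H0 L \<subseteq> H0"
  unfolding H00_def using L_maps by (intro complex_vector.span_minimal H0_subspace) auto

lemma H0_dense: "closure H0 = UNIV"
  using closure_mono[OF H00_subset_H0] H00_dense by auto

lemma norm_L_squared:
  assumes f: "f \<in> Cc A" and \<xi>: "\<xi> \<in> H0"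
  shows "(norm (L f \<xi>))\<^sup>2 = cmod (cinner \<xi> (L (conv G A (sec_star G A f) f) \<xi>))"
proof -
  have "cinner (L f \<xi>) (L f \<xi>) = cinner (L (sec_star G A f) (L f \<xi>)) \<xi>"
    by (rule L_star[OF f \<xi> L_maps[OF f \<xi>]])
  also have "\<dots> = cinner (L (conv G A (sec_star G A f) f) \<xi>) \<xi>"
    by (simp add: L_conv[OF sec_star_in_Cc[OF f] f \<xi>])
  finally have "cmod (cinner (L f \<xi>) (L f \<xi>)) = cmod (cinner (L (conv G A (sec_star G A f) f) \<xi>) \<xi>)"
    by simp
  also have "\<dots> = cmod (cinner \<xi> (L (conv G A (sec_star G A f) f) \<xi>))"
    by (metis cinner_commute complex_mod_cnj)
  finally show ?thesis
    by (simp add: cinner_self norm_power)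
qed

text \<open>The constant \<open>C\<close> that continuity provides depends on \<open>\<xi>\<close> and on the support. It disappears when
  \<open>2\<^bsup>n\<^esup>\<close>-th roots are taken: with \<open>f\<^sub>n\<close> the iterates of \<open>f \<mapsto> f\<^sup>* * f\<close>, the numbers
  \<open>x n = \<parallel>L(f\<^sub>n)\<xi>\<parallel>\<close> satisfy \<open>(x n)\<^sup>2 = \<bar>\<langle>\<xi>, L(f\<^sub>n\<^sub>+\<^sub>1)\<xi>\<rangle>\<bar>\<close>, which is at most \<open>\<parallel>\<xi>\<parallel> x (n + 1)\<close> by the
  Cauchy--Schwarz inequality and at most \<open>C s\<^bsup>2^(n+1)\<^esup>\<close> by continuity.\<close>

lemma norm_L_le:
  assumes U: "bisection G U" and K: "compact K" "K \<subseteq> U" and f: "f \<in> sections_on A U K"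
    and s: "s > 0" "\<And>\<gamma>. bnorm A (f \<gamma>) \<le> s" and \<xi>: "\<xi> \<in> H0"
  shows "norm (L f \<xi>) \<le> s * norm \<xi>"
proof -
  let ?V = "src G ` U" and ?K = "src G ` K"
  have V: "bisection G ?V" "compact ?K" "?K \<subseteq> ?V"
    using bisection_src_image[OF U] K(2) compact_continuous_image[OF continuous_src K(1)] by auto
  have "cinner \<xi> (L (sec_scale A c f) \<xi>) = c * cinner \<xi> (L f \<xi>)" if "f \<in> Cc A" for c f
    by (simp add: L_scale[OF that \<xi>] cinner_scaleC_right)
  then obtain C where C: "\<forall>f\<in>sections_on A ?V ?K. \<forall>s>0. (\<forall>\<gamma>. bnorm A (f \<gamma>) \<le> s) \<longrightarrow>
      cmod (cinner \<xi> (L f \<xi>)) \<le> C * s"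
    using continuous_functional_bounded_on_sections[OF L_continuous[OF \<xi> \<xi>] _ V] by metis
  define F where "F = star_square f"
  have F_Suc: "F (Suc n) \<in> sections_on A ?V ?K" for n
    unfolding F_def by (rule star_square_sections_on[OF U K(2) f])
  have F_Cc: "F n \<in> Cc A" for n
    using bisection_sections_on_in_Cc[OF U K f] bisection_sections_on_in_Cc[OF V F_Suc]
    by (cases n) (simp_all add: F_def)
  have sq: "(norm (L (F n) \<xi>))\<^sup>2 = cmod (cinner \<xi> (L (F (Suc n)) \<xi>))" for n
    using norm_L_squared[OF F_Cc \<xi>, of n] by (simp add: F_def)
  have "norm (L (F 0) \<xi>) \<le> norm \<xi> * s"
  proof (rule bound_from_quadratic_recursion[where x = "\<lambda>n. norm (L (F n) \<xi>)"])
    show "(norm (L (F n) \<xi>))\<^sup>2 \<le> norm \<xi> * norm (L (F (Suc n)) \<xi>)" for n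
      unfolding sq by (rule norm_cinner_le)
    show "(norm (L (F n) \<xi>))\<^sup>2 \<le> C * s ^ 2 ^ Suc n" for n
      unfolding sq using bnorm_star_square_le[OF U K(2) f s(2)] s(1)
      by (intro C[rule_format] F_Suc) (simp_all add: F_def del: star_square.simps power_Suc)
  qed (use s in auto)
  then show ?thesis
    by (simp add: F_def mult.commute)
qed

lemma L_bounded:
  assumes "f \<in> Cc A"
  shows "\<exists>B. \<forall>\<xi>\<in>H0. norm (L f \<xi>) \<le> B * norm \<xi>"
proof -
  let ?S = "{f \<in> Cc A. \<exists>B. \<forall>\<xi>\<in>H0. norm (L f \<xi>) \<le> B * norm \<xi>}"
  have "Cc A \<subseteq> ?S"
  proof (rule Cc_subset_if_contains_bisection_sections)
    have "L (bzero A) \<xi> = 0" if "\<xi> \<in> H0" for \<xi>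
      using L_scale[OF bzero_in_Cc that, of 0] by (simp add: sec_scale_def)
    then have zero: "bzero A \<in> ?S"
      using bzero_in_Cc by (auto intro!: exI[of _ 0])
    have add: "sec_add A f g \<in> ?S" if fg: "f \<in> ?S" "g \<in> ?S" for f g
    proof -
      obtain B B' where B: "\<And>\<xi>. \<xi> \<in> H0 \<Longrightarrow> norm (L f \<xi>) \<le> B * norm \<xi>"
        "\<And>\<xi>. \<xi> \<in> H0 \<Longrightarrow> norm (L g \<xi>) \<le> B' * norm \<xi>"
        using fg by blast
      have "norm (L (sec_add A f g) \<xi>) \<le> (B + B') * norm \<xi>" if "\<xi> \<in> H0" for \<xi>
        using norm_triangle_mono[OF B[OF that]] fg L_add that by (simp add: distrib_right)
      then show ?thesis
        using sec_add_in_Cc fg by blast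
    qed
    have scale: "sec_scale A c f \<in> ?S" if f: "f \<in> ?S" for f c
    proof -
      obtain B where B: "\<And>\<xi>. \<xi> \<in> H0 \<Longrightarrow> norm (L f \<xi>) \<le> B * norm \<xi>"
        using f by blast
      have "norm (L (sec_scale A c f) \<xi>) \<le> (cmod c * B) * norm \<xi>" if "\<xi> \<in> H0" for \<xi>
        using mult_left_mono[OF B[OF that], of "cmod c"] f L_scale that
        by (simp add: norm_scaleC mult.assoc)
      then show ?thesis
        using sec_scale_in_Cc f by blast
    qed
    show "sec_subspace A ?S"
      unfolding sec_subspace_def using zero add scale by blast
  next
    fix U K f assume U: "bisection G U" and K: "compact K" "K \<subseteq> U" and f: "f \<in> sections_on A U K"
    \<comment> \<open>The estimate requires a positive bound, also if \<open>f\<close> is zero.\<close>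
    have s: "bnorm A (f \<gamma>) \<le> sup_norm A f + 1" "sup_norm A f + 1 > 0" for \<gamma>
      using bnorm_le_sup_norm[OF f K, of \<gamma>] norm_nonneg[of "f \<gamma>"] by linarith+
    show "f \<in> ?S"
      using norm_L_le[OF U K f s(2,1)] bisection_sections_on_in_Cc[OF U K f] by blast
  qed
  then show ?thesis using assms by blast
qed

text \<open>The extension is chosen for every \<open>h\<close> for which \<open>L h\<close> has one, not only for \<open>h\<close> in \<^const>\<open>Cc\<close>.
  This makes \<open>extension_eqI\<close> applicable to a convolution product \<open>f * g\<close> on the sole ground that
  the composite of the extensions of \<open>L f\<close> and \<open>L g\<close> extends \<open>L (f * g)\<close>.\<close>

definition extension :: "('g \<Rightarrow> 'a) \<Rightarrow> 'h \<Rightarrow>\<^sub>L 'h" where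
  "extension h = (SOME T. T \<in> bounded_ops \<and> (\<forall>\<xi>\<in>H0. blinfun_apply T \<xi> = L h \<xi>))"

lemma extension_bounded_ops: "h \<in> Cc A \<Longrightarrow> extension h \<in> bounded_ops"
  and extension_H0: "h \<in> Cc A \<Longrightarrow> \<xi> \<in> H0 \<Longrightarrow> extension h \<xi> = L h \<xi>"
proof -
  have "extension h \<in> bounded_ops \<and> (\<forall>\<xi>\<in>H0. extension h \<xi> = L h \<xi>)" if h: "h \<in> Cc A"
  proof -
    obtain B where "\<forall>\<xi>\<in>H0. norm (L h \<xi>) \<le> B * norm \<xi>"
      using L_bounded[OF h] by blast
    then have "\<exists>T\<in>bounded_ops. \<forall>\<xi>\<in>H0. blinfun_apply T \<xi> = L h \<xi>"
      by (intro bounded_extension_from_dense[OF H0_subspace H0_dense L_linear[OF h]]) auto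
    then have "\<exists>T. T \<in> bounded_ops \<and> (\<forall>\<xi>\<in>H0. blinfun_apply T \<xi> = L h \<xi>)"
      by blast
    then show ?thesis
      unfolding extension_def by (rule someI_ex)
  qed
  then show "h \<in> Cc A \<Longrightarrow> extension h \<in> bounded_ops"
    and "h \<in> Cc A \<Longrightarrow> \<xi> \<in> H0 \<Longrightarrow> extension h \<xi> = L h \<xi>"
    by auto
qed

lemma blinfun_eq_from_H0:
  fixes S T :: "'h \<Rightarrow>\<^sub>L 'h"
  assumes "\<And>\<xi>. \<xi> \<in> H0 \<Longrightarrow> S \<xi> = T \<xi>"
  shows "S = T"
  by (rule blinfun_eqI, rule eq_from_dense[OF H0_dense])
    (auto intro!: continuous_intros blinfun.continuous_on simp: assms)

lemma extension_eqI:
  assumes "T \<in> bounded_ops" "\<And>\<xi>. \<xi> \<in> H0 \<Longrightarrow> blinfun_apply T \<xi> = L h \<xi>"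
  shows "extension h = T"
proof -
  have "extension h \<in> bounded_ops \<and> (\<forall>\<xi>\<in>H0. extension h \<xi> = L h \<xi>)"
    unfolding extension_def by (rule someI[of _ T]) (use assms in auto)
  then show ?thesis
    using assms by (intro blinfun_eq_from_H0) auto
qed

lemma extension_add:
  assumes "f \<in> Cc A" "g \<in> Cc A"
  shows "extension (sec_add A f g) = extension f + extension g"
  using assms extension_H0 sec_add_in_Cc L_add
  by (intro blinfun_eq_from_H0) (simp add: blinfun.add_left)

lemma extension_scale:
  assumes f: "f \<in> Cc A"
  shows "extension (sec_scale A c f) \<xi> = c *\<^sub>C extension f \<xi>"
  by (rule eq_from_dense[OF H0_dense])
    (use f extension_H0 sec_scale_in_Cc L_scale in \<open>auto intro!: continuous_intros blinfun.continuous_on\<close>)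

lemma extension_conv:
  assumes f: "f \<in> Cc A" and g: "g \<in> Cc A"
  shows "extension (conv G A f g) = extension f o\<^sub>L extension g"
proof (rule extension_eqI)
  show "extension f o\<^sub>L extension g \<in> bounded_ops"
    using extension_bounded_ops[OF f] extension_bounded_ops[OF g]
    by (simp add: bounded_ops_def clinear_on_def)
  show "(extension f o\<^sub>L extension g) \<xi> = L (conv G A f g) \<xi>" if "\<xi> \<in> H0" for \<xi>
    using that extension_H0 f g L_conv L_maps by simp
qed

lemma extension_star:
  assumes f: "f \<in> Cc A"
  shows "cinner \<eta> (extension f \<xi>) = cinner (extension (sec_star G A f) \<eta>) \<xi>"
proof -
  have H0: "cinner \<eta> (extension f \<xi>) = cinner (extension (sec_star G A f) \<eta>) \<xi>"
    if "\<eta> \<in> H0" "\<xi> \<in> H0" for \<xi> \<eta>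
    using that extension_H0 f sec_star_in_Cc L_star by simp
  note cont = continuous_on_cinner blinfun.continuous_on continuous_on_const continuous_on_id
  have "cinner \<eta> (extension f \<xi>) = cinner (extension (sec_star G A f) \<eta>) \<xi>" if \<eta>: "\<eta> \<in> H0" for \<xi> \<eta>
    using H0_dense
  proof (rule eq_from_dense)
    show "continuous_on UNIV (\<lambda>\<xi>. cinner \<eta> (extension f \<xi>))"
      by (intro cont)
    show "continuous_on UNIV (cinner (extension (sec_star G A f) \<eta>))"
      using cont(1)[OF cont(3,4)] by simp
  qed (rule H0[OF \<eta>])
  then have H0': "\<And>\<eta>. \<eta> \<in> H0 \<Longrightarrow> cinner \<eta> (extension f \<xi>) = cinner (extension (sec_star G A f) \<eta>) \<xi>" .
  show ?thesis
    using H0_dense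
  proof (rule eq_from_dense[where p = "\<lambda>\<eta>. cinner \<eta> (extension f \<xi>)" and x = \<eta>])
    show "continuous_on UNIV (\<lambda>\<eta>. cinner \<eta> (extension f \<xi>))"
      by (intro cont)
    show "continuous_on UNIV (\<lambda>\<eta>. cinner (extension (sec_star G A f) \<eta>) \<xi>)"
      by (intro cont)
  qed (rule H0')
qed

lemma extension_nondegenerate:
  "closure (cspan {extension f \<xi> | f \<xi>. f \<in> Cc A}) = UNIV"
proof -
  have "H00 A H0 L \<subseteq> cspan {extension f \<xi> | f \<xi>. f \<in> Cc A}"
    unfolding H00_def using extension_H0 by (intro complex_vector.span_mono) (auto, metis)
  from closure_mono[OF this] show ?thesis
    using H00_dense by auto
qed

lemma cc_representation_extension: "cc_representation G A extension"
  by unfold_locales (rule extension_bounded_ops extension_add extension_scale extension_conv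
      extension_star extension_nondegenerate; assumption?)+

lemma norm_extension_le:
  assumes "bisection G U" "compact K" "K \<subseteq> U" "f \<in> sections_on A U K" "s > 0"
    "\<And>\<gamma>. bnorm A (f \<gamma>) \<le> s"
  shows "norm (extension f) \<le> s"
  using assms norm_L_le extension_H0[OF bisection_sections_on_in_Cc]
  by (intro blinfun_norm_le_from_dense[OF H0_dense]) auto

lemma norm_extension_scale:
  assumes "f \<in> Cc A"
  shows "norm (extension (sec_scale A c f)) \<le> cmod c * norm (extension f)"
proof (rule norm_blinfun_bound)
  fix \<xi>
  show "norm (extension (sec_scale A c f) \<xi>) \<le> cmod c * norm (extension f) * norm \<xi>"
    using mult_left_mono[OF norm_blinfun[of "extension f" \<xi>], of "cmod c"]
    by (simp add: extension_scale[OF assms] norm_scaleC mult.assoc)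
qed simp

text \<open>A ball around zero for the seminorm \<open>f \<mapsto> \<parallel>extension f\<parallel>\<close> is a neighbourhood of zero, because over
  each bisection this seminorm is at most the supremum norm.\<close>

lemma zero_nhd_norm_extension:
  assumes e: "e > 0"
  shows "zero_nhd G A {f \<in> Cc A. norm (extension f) < e}" (is "zero_nhd G A ?N")
  unfolding zero_nhd_def
proof (intro conjI allI impI ballI)
  fix f g and t :: real assume f: "f \<in> ?N" and g: "g \<in> ?N" and t: "0 \<le> t \<and> t \<le> 1"
  let ?f = "sec_scale A (of_real t) f" and ?g = "sec_scale A (of_real (1 - t)) g"
  have fg: "?f \<in> Cc A" "?g \<in> Cc A"
    using f g by (auto intro: sec_scale_in_Cc)
  have "norm (extension (sec_add A ?f ?g)) \<le> norm (extension ?f) + norm (extension ?g)"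
    by (simp only: extension_add[OF fg] norm_triangle_ineq)
  also have "\<dots> \<le> t * norm (extension f) + (1 - t) * norm (extension g)"
    using norm_extension_scale[of f "of_real t"] norm_extension_scale[of g "of_real (1 - t)"] f g t
    by (simp only: norm_of_real) simp
  also have "\<dots> < e"
    using f g t by (intro convex_bound_lt) auto
  finally show "sec_add A ?f ?g \<in> ?N"
    using sec_add_in_Cc[OF fg] by simp
next
  fix f c assume f: "f \<in> ?N" and c: "cmod c \<le> 1"
  have "norm (extension (sec_scale A c f)) \<le> 1 * norm (extension f)"
    using norm_extension_scale[of f c] f mult_right_mono[OF c, of "norm (extension f)"] by auto
  then show "sec_scale A c f \<in> ?N"
    using f sec_scale_in_Cc by auto
next
  fix f assume f: "f \<in> Cc A"
  define t where "t = e / (norm (extension f) + 1)"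
  have t: "t > 0"
    using e by (simp add: t_def add_nonneg_pos)
  have "norm (extension (sec_scale A (of_real t) f)) \<le> t * norm (extension f)"
    using norm_extension_scale[OF f, of "of_real t"] t by simp
  also have "\<dots> < t * (norm (extension f) + 1)"
    using t by simp
  also have "\<dots> = e"
    by (simp add: t_def add_nonneg_eq_0_iff)
  finally show "\<exists>t::real. t > 0 \<and> sec_scale A (of_real t) f \<in> ?N"
    using t f sec_scale_in_Cc by blast
next
  fix U K assume UK: "bisection G U \<and> compact K \<and> K \<subseteq> U"
  have "f \<in> ?N" if f: "f \<in> sections_on A U K" and small: "sup_norm A f < e" for f
  proof -
    \<comment> \<open>The midpoint of \<open>sup_norm A f\<close> and \<open>e\<close> is a positive bound even if \<open>f\<close> is zero.\<close>
    have le: "bnorm A (f \<gamma>) \<le> (sup_norm A f + e) / 2" "0 < (sup_norm A f + e) / 2" for \<gamma>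
      using bnorm_le_sup_norm[OF f, of \<gamma>] norm_nonneg[of "f \<gamma>"] UK small e by auto
    have "norm (extension f) \<le> (sup_norm A f + e) / 2"
      using UK f le by (intro norm_extension_le[of U K]) auto
    then show ?thesis
      using small f UK bisection_sections_on_in_Cc by auto
  qed
  then show "\<exists>e>0. \<forall>f\<in>sections_on A U K. sup_norm A f < e \<longrightarrow> f \<in> ?N"
    using e by blast
qed auto

lemma continuous_map_extension:
  "continuous_map (ind_limit_topology G A) euclidean extension"
  unfolding continuous_map_def
proof (intro conjI allI impI)
  fix V :: "('h \<Rightarrow>\<^sub>L 'h) set" assume "openin euclidean V"
  then have V: "open V" by simp
  show "openin (ind_limit_topology G A) {f \<in> topspace (ind_limit_topology G A). extension f \<in> V}"
    unfolding openin_ind_limit_topology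
  proof (intro conjI ballI)
    fix f assume "f \<in> {f \<in> topspace (ind_limit_topology G A). extension f \<in> V}"
    then have f: "f \<in> Cc A" "extension f \<in> V" by auto
    then obtain e where e: "e > 0" "ball (extension f) e \<subseteq> V"
      using V openE by blast
    have "extension (sec_add A f g) \<in> ball (extension f) e" 
      if "g \<in> Cc A" "norm (extension g) < e" for g
      using that by (simp add: extension_add[OF f(1)] dist_norm)
    then show "\<exists>N. zero_nhd G A N \<and>
        (\<forall>g\<in>N. sec_add A f g \<in> {f \<in> topspace (ind_limit_topology G A). extension f \<in> V})"
      using zero_nhd_norm_extension[OF e(1)] e(2) sec_add_in_Cc[OF f(1)]
      by (intro exI[of _ "{g \<in> Cc A. norm (extension g) < e}"]) auto
  qed auto
qed auto

lemma extension_H00: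
  assumes h: "h \<in> Cc A"
  shows "extension h ` H00 A H0 L \<subseteq> H00 A H0 L"
proof -
  let ?B = "{L f \<xi> | f \<xi>. f \<in> Cc A \<and> \<xi> \<in> H0}"
  have lin: "extension h (x + y) = extension h x + extension h y"
    "extension h (c *\<^sub>C x) = c *\<^sub>C extension h x" for x y c
    using extension_bounded_ops[OF h] by (auto simp: bounded_ops_def clinear_on_def)
  have zero: "extension h 0 = 0"
    by (rule blinfun.zero_right)
  have "cspan ?B \<subseteq> {v. extension h v \<in> cspan ?B}"
  proof (rule complex_vector.span_minimal)
    show "?B \<subseteq> {v. extension h v \<in> cspan ?B}"
    proof clarify
      fix f \<xi> assume f: "f \<in> Cc A" and \<xi>: "\<xi> \<in> H0"
      have "extension h (L f \<xi>) = L h (L f \<xi>)"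
        by (rule extension_H0[OF h L_maps[OF f \<xi>]])
      then have "extension h (L f \<xi>) \<in> ?B"
        using h L_maps[OF f \<xi>] by blast
      then show "extension h (L f \<xi>) \<in> cspan ?B"
        by (rule complex_vector.span_base)
    qed
    show "csubspace {v. extension h v \<in> cspan ?B}"
      by (auto simp: complex_vector.subspace_def lin zero complex_vector.span_zero
          intro: complex_vector.span_add complex_vector.span_scale)
  qed
  then show ?thesis
    unfolding H00_def by blast
qed

end

section \<open>Extension to a representation\<close>

theorem proposition2p13:
  fixes G :: "'g::topological_space groupoid_data"
    and A :: "('g, 'a::topological_space) fell_bundle_data"
    and H0 :: "'h::complex_hilbert_space set"
    and L :: "('g \<Rightarrow> 'a) \<Rightarrow> 'h \<Rightarrow> 'h"
  assumes "etale_groupoid G"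
    and "fell_bundle G A"
    and "closure H0 = UNIV"
    and "pre_representation G A H0 L"
  shows "\<exists>(M' :: ('g \<Rightarrow> 'a) \<Rightarrow> 'h \<Rightarrow> 'h) (M :: ('g \<Rightarrow> 'a) \<Rightarrow> 'h \<Rightarrow>\<^sub>L 'h).
    (\<forall>h\<in>Cc A. M' h ` H00 A H0 L \<subseteq> H00 A H0 L \<and> clinear_on (H00 A H0 L) (M' h) \<and>
       (\<forall>f\<in>Cc A. \<forall>\<xi>\<in>H0. M' h (L f \<xi>) = L (conv G A h f) \<xi>)) \<and>
    (\<forall>h\<in>Cc A. M h \<in> bounded_ops \<and> (\<forall>v\<in>H00 A H0 L. M h v = M' h v)) \<and>
    cc_representation G A M \<and>
    continuous_map (ind_limit_topology G A) euclidean M \<and>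
    (\<forall>h\<in>Cc A. \<forall>\<xi>\<in>H0. M h \<xi> = L h \<xi>)"
proof -
  interpret etale_groupoid G by fact
  interpret pre_representation G A H0 L by fact
  interpret etale_pre_representation G A H0 L by unfold_locales
  show ?thesis
  proof (intro exI conjI ballI)
    fix h assume h: "h \<in> Cc A"
    show "extension h ` H00 A H0 L \<subseteq> H00 A H0 L"
      by (rule extension_H00[OF h])
    show "clinear_on (H00 A H0 L) (extension h)"
      using extension_bounded_ops[OF h] by (simp add: bounded_ops_def clinear_on_def)
    show "extension h (L f \<xi>) = L (conv G A h f) \<xi>" if "f \<in> Cc A" "\<xi> \<in> H0" for f \<xi>
      using that h by (simp add: L_maps extension_H0 L_conv)
    show "extension h \<in> bounded_ops"
      by (rule extension_bounded_ops[OF h])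
    show "extension h \<xi> = L h \<xi>" if "\<xi> \<in> H0" for \<xi>
      by (rule extension_H0[OF h that])
  qed (use cc_representation_extension continuous_map_extension in auto)
qed

end
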